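(* Let $R$ be a 2-Henselian valuation ring with $v(2)>0$. (1) For each generalized Arf invariant $\eta$ with $v(\eta)\leq2v(2)$ the set of fine classes of minimal norms arising from $\eta$ is well-defined; that is, the multiplicative group $(R^{*})^{2}\big(1+\frac{4}{\tau}R_{AS}\big)$ does not depend on the choice of the element $\tau\in R$ representing $\eta$. (2) Let $\eta$ be a generalized Arf invariant with $v(\eta)>v(2)$. Then the isomorphism classes of lattices $M_{\alpha,\beta}$ with generalized Arf invariant $\eta$ and with $\beta\in2R$ of maximal valuation are characterized precisely by their fine Arf invariant and their class of minimal norms. That is, if $M_{\alpha,\beta}$ and $M_{\gamma,\delta}$ both have generalized Arf invariant $\eta$, where $v(\alpha)\leq v(\beta)$, $v(\gamma)\leq v(\delta)$, and $\beta,\delta\in2R$ are of maximal valuation, then $M_{\alpha,\beta}\cong M_{\gamma,\delta}$ if and only if the two lattices have the same fine Arf invariant and the same class of minimal norms.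
   Context: A valuation ring $R$ is an integral domain with fraction field $\mathbb{K}$, a totally ordered abelian group $\Gamma$ (additive, arbitrary rank) and a surjective homomorphism $v:\mathbb{K}^{*}\to\Gamma$ with $v(x+y)\geq\min\{v(x),v(y)\}$, extended by $v(0)=\infty$, such that $R=\{x\in\mathbb{K}: v(x)\geq0\}$. For $\gamma\in\Gamma$, $I_{\gamma}=\{x\in\mathbb{K}: v(x)>\gamma\}$; $I_{0}$ is the maximal ideal. $R$ is 2-Henselian if $2\neq0$ in $R$ and for every monic $f\in R[x]$ of degree 2 and every $a\in R$ with $v(f(a))>0$ and $v(f'(a))=0$ there is a root $b\in R$ of $f$ with $b-a\in I_{0}$. For $\alpha,\beta\in R$, $M_{\alpha,\beta}$ is the free rank 2 $R$-module with basis $x,y$ and symmetric bilinear form given by $x^{2}=(x,x)=\alpha$, $(x,y)=1$, $y^{2}=(y,y)=\beta$; isomorphisms are $R$-linear bijections preserving the form. We always take $v(\alpha)\leq v(\beta)$. An element $z\in M$ is primitive if $M/Rz$ is torsion-free. "$\beta$ has maximal valuation" means $v(\beta)\geq v(z^{2})$ for every primitive $z\in M_{\alpha,\beta}$. A lattice is isotropic if it contains a non-zero $z$ with $z^{2}=0$. An element of $\Gamma$ is even if divisible by 2 in $\Gamma$, and odd otherwise. An element $a\in R$ of even valuation is an approximate square if $a-b^{2}\in I_{v(a)}$ for some $b\in R$. For even $u$, $J_{u}$ is the union of $I_{u}$ and the set of approximate squares of valuation $u$ (an additive subgroup of $R$). Put $\rho(x)=x^{2}-x$ and $R_{AS}=\rho(R)$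 (an additive subgroup). Generalized Arf invariant of $M_{\alpha,\beta}$ ($\beta$ of maximal valuation): 0 ("vanishing") if $M_{\alpha,\beta}$ is isotropic (i.e. $\beta=0$); the class $\alpha\beta+I_{v(\alpha\beta)}$ ("odd") if $v(\alpha)+v(\beta)<2v(2)$ is odd; the class $\alpha\beta+J_{v(\alpha\beta)}$ ("even") if $0<v(\alpha)+v(\beta)<2v(2)$ is even; the image of $\alpha\beta$ in $4R/4R_{AS}$ ("exact") if $v(\alpha)+v(\beta)=2v(2)$. A generalized Arf invariant is any class $\eta$ arising in this way; its valuation $v(\eta)$ is $v(\alpha\beta)$ ($\infty$ if vanishing). If $\eta$ is non-vanishing, then all elements $\tau\in R$ of the class $\eta$ (the representatives of $\eta$) have valuation $v(\eta)$. Let $S=\{t^{2}-2t: t\in R,\ 2v(t)>v(2)\}$, an additive subgroup of $I_{v(2)}$. If the generalized Arf invariant of $M_{\alpha,\beta}$ has valuation larger than $v(2)$, the fine Arf invariant of $M_{\alpha,\beta}$ is the set of elements of valuation $v(\alpha\beta)$ in the class $\alpha\beta+S$. Classes of minimal norms. A coarse class of minimal norms is an element of $(R/2R)/(R^{*})^{2}$, the set of orbits of $R/2R$ under multiplication by squares of units. For a non-vanishing generalized Arf invariant $\eta$ (so $v(\eta)\leq2v(2)$), a fine class of minimal norms arising from $\eta$ is the orbit of an element of $R$, of valuation $u$ with $2u\leq v(\eta)$, under multiplication by the multiplicative group $(R^{*})^{2}\big(1+\frac{4}{\tau}R_{AS}\big)$, where $\tau\in R$ represents $\eta$. The class of minimal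 norms of $M_{\alpha,\beta}$ ($\beta$ of maximal valuation, generalized Arf invariant $\eta$) is: if $v(\beta)>v(2)$, the image of $\alpha$ in the set of coarse classes; if $v(\beta)=v(2)$ (so $v(\eta)\geq v(2)$), the fine class of $\alpha$ arising from $\eta$. A coarse class is never considered equal to a fine class. *)

theory Defs
  imports
    "HOL-Computational_Algebra.Polynomial"
    "HOL-Library.Extended"
    "HOL-Library.Product_Plus"
    "HOL-Library.Set_Algebras"
begin

section \<open>Valuation rings\<close>

text \<open>
  A valuation is given on the fraction field \<open>'k\<close>, with values in the totally ordered abelian
  group \<open>'g\<close> extended by \<open>\<infinity>\<close>. The type \<open>'g extended\<close> also has a least element \<open>-\<infinity>\<close>, which is
  excluded as a value.
\<close>

definition valuation :: "('k::field \<Rightarrow> 'g::linordered_ab_group_add extended) \<Rightarrow> bool" where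
  "valuation v \<longleftrightarrow>
     v 0 = \<infinity> \<and>
     (\<forall>x. x \<noteq> 0 \<longrightarrow> (\<exists>\<gamma>. v x = Fin \<gamma>)) \<and>
     (\<forall>\<gamma>. \<exists>x. x \<noteq> 0 \<and> v x = Fin \<gamma>) \<and>
     (\<forall>x y. x \<noteq> 0 \<longrightarrow> y \<noteq> 0 \<longrightarrow> v (x * y) = v x + v y) \<and>
     (\<forall>x y. v (x + y) \<ge> min (v x) (v y))"

definition vring :: "('k::field \<Rightarrow> 'g::linordered_ab_group_add extended) \<Rightarrow> 'k set" where
  "vring v = {x. v x \<ge> 0}"

definition vunits :: "('k::field \<Rightarrow> 'g::linordered_ab_group_add extended) \<Rightarrow> 'k set" where
  "vunits v = {a \<in> vring v. \<exists>b\<in>vring v. a * b = 1}"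

definition videal :: "('k::field \<Rightarrow> 'g::linordered_ab_group_add extended) \<Rightarrow> 'g extended \<Rightarrow> 'k set" where
  "videal v \<gamma> = {x. v x > \<gamma>}"

definition two_henselian :: "('k::field \<Rightarrow> 'g::linordered_ab_group_add extended) \<Rightarrow> bool" where
  "two_henselian v \<longleftrightarrow>
     (2::'k) \<noteq> 0 \<and>
     (\<forall>f a. (\<forall>i. coeff f i \<in> vring v) \<longrightarrow> degree f = 2 \<longrightarrow> lead_coeff f = 1 \<longrightarrow> a \<in> vring v \<longrightarrow>
        v (poly f a) > 0 \<longrightarrow> v (poly (pderiv f) a) = 0 \<longrightarrow>
        (\<exists>b\<in>vring v. poly f b = 0 \<and> b - a \<in> videal v 0))"


section \<open>The lattices \<open>M\<^bsub>\<alpha>,\<beta>\<^esub>\<close>\<close>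

text \<open>
  The underlying module is \<open>R \<times> R\<close>, where \<open>(a, b)\<close> stands for \<open>a x + b y\<close>; it does not depend on
  \<open>\<alpha>\<close> and \<open>\<beta>\<close>, which enter through the bilinear form only.
\<close>

definition mcarrier :: "('k::field \<Rightarrow> 'g::linordered_ab_group_add extended) \<Rightarrow> ('k \<times> 'k) set" where
  "mcarrier v = vring v \<times> vring v"

definition mscale :: "'k::field \<Rightarrow> 'k \<times> 'k \<Rightarrow> 'k \<times> 'k" where
  "mscale r z = (r * fst z, r * snd z)"

definition mform :: "'k::field \<Rightarrow> 'k \<Rightarrow> 'k \<times> 'k \<Rightarrow> 'k \<times> 'k \<Rightarrow> 'k" where
  "mform \<alpha> \<beta> z w =
     \<alpha> * (fst z * fst w) + (fst z * snd w + snd z * fst w) + \<beta> * (snd z * snd w)"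

definition lattice_iso ::
  "('k::field \<Rightarrow> 'g::linordered_ab_group_add extended) \<Rightarrow> 'k \<Rightarrow> 'k \<Rightarrow> 'k \<Rightarrow> 'k \<Rightarrow> bool" where
  "lattice_iso v \<alpha> \<beta> \<gamma> \<delta> \<longleftrightarrow>
     (\<exists>\<phi>. bij_betw \<phi> (mcarrier v) (mcarrier v) \<and>
          (\<forall>z\<in>mcarrier v. \<forall>w\<in>mcarrier v. \<phi> (z + w) = \<phi> z + \<phi> w) \<and>
          (\<forall>r\<in>vring v. \<forall>z\<in>mcarrier v. \<phi> (mscale r z) = mscale r (\<phi> z)) \<and>
          (\<forall>z\<in>mcarrier v. \<forall>w\<in>mcarrier v. mform \<gamma> \<delta> (\<phi> z) (\<phi> w) = mform \<alpha> \<beta> z w))"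

definition isotropic ::
  "('k::field \<Rightarrow> 'g::linordered_ab_group_add extended) \<Rightarrow> 'k \<Rightarrow> 'k \<Rightarrow> bool" where
  "isotropic v \<alpha> \<beta> \<longleftrightarrow> (\<exists>z\<in>mcarrier v. z \<noteq> 0 \<and> mform \<alpha> \<beta> z z = 0)"

text \<open>
  Primitivity of \<open>z\<close> says that \<open>M / R z\<close> is torsion-free. As \<open>M / 0\<close> is torsion-free, the zero
  vector has to be excluded explicitly; otherwise maximality of the valuation of \<open>\<beta>\<close> would
  force \<open>\<beta> = 0\<close>.
\<close>

definition primitive :: "('k::field \<Rightarrow> 'g::linordered_ab_group_add extended) \<Rightarrow> 'k \<times> 'k \<Rightarrow> bool" where
  "primitive v z \<longleftrightarrow>
     z \<in> mcarrier v \<and> z \<noteq> 0 \<and>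
     (\<forall>w\<in>mcarrier v. \<forall>r\<in>vring v. r \<noteq> 0 \<longrightarrow>
        mscale r w \<in> (\<lambda>s. mscale s z) ` vring v \<longrightarrow> w \<in> (\<lambda>s. mscale s z) ` vring v)"

definition maximal_valuation ::
  "('k::field \<Rightarrow> 'g::linordered_ab_group_add extended) \<Rightarrow> 'k \<Rightarrow> 'k \<Rightarrow> bool" where
  "maximal_valuation v \<alpha> \<beta> \<longleftrightarrow> (\<forall>z. primitive v z \<longrightarrow> v \<beta> \<ge> v (mform \<alpha> \<beta> z z))"

definition reduced ::
  "('k::field \<Rightarrow> 'g::linordered_ab_group_add extended) \<Rightarrow> 'k \<Rightarrow> 'k \<Rightarrow> bool" where
  "reduced v \<alpha> \<beta> \<longleftrightarrow>
     \<alpha> \<in> vring v \<and> \<beta> \<in> vring v \<and> v \<alpha> \<le> v \<beta> \<and> maximal_valuation v \<alpha> \<beta>"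


section \<open>Generalized Arf invariants\<close>

definition even_val :: "'g::linordered_ab_group_add extended \<Rightarrow> bool" where
  "even_val u \<longleftrightarrow> (\<exists>\<gamma>. u = Fin (\<gamma> + \<gamma>))"

definition odd_val :: "'g::linordered_ab_group_add extended \<Rightarrow> bool" where
  "odd_val u \<longleftrightarrow> (\<exists>\<gamma>. u = Fin \<gamma>) \<and> \<not> even_val u"

definition approx_square ::
  "('k::field \<Rightarrow> 'g::linordered_ab_group_add extended) \<Rightarrow> 'k \<Rightarrow> bool" where
  "approx_square v a \<longleftrightarrow>
     a \<in> vring v \<and> even_val (v a) \<and> (\<exists>b\<in>vring v. a - b\<^sup>2 \<in> videal v (v a))"

definition J_set ::
  "('k::field \<Rightarrow> 'g::linordered_ab_group_add extended) \<Rightarrow> 'g extended \<Rightarrow> 'k set" where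
  "J_set v u = videal v u \<union> {a. approx_square v a \<and> v a = u}"

definition R_AS :: "('k::field \<Rightarrow> 'g::linordered_ab_group_add extended) \<Rightarrow> 'k set" where
  "R_AS v = (\<lambda>t. t\<^sup>2 - t) ` vring v"

text \<open>
  The constructors record the quotient in which the invariant lies; their argument is the
  class itself, as a coset in \<open>'k\<close>.
\<close>

datatype 'k gen_arf =
    Vanishing
  | Odd_class "'k set"
  | Even_class "'k set"
  | Exact_class "'k set"

text \<open>
  The invariant is a relation because it need not exist: \<open>v \<alpha> + v \<beta> = 0\<close> is not covered if
  the lattice is anisotropic.
\<close>

inductive has_gen_arf ::
  "('k::field \<Rightarrow> 'g::linordered_ab_group_add extended) \<Rightarrow> 'k \<Rightarrow> 'k \<Rightarrow> 'k gen_arf \<Rightarrow> bool"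
  for v :: "'k::field \<Rightarrow> 'g::linordered_ab_group_add extended" and \<alpha> \<beta> :: 'k where
  vanishing:
    "reduced v \<alpha> \<beta> \<Longrightarrow> isotropic v \<alpha> \<beta> \<Longrightarrow> has_gen_arf v \<alpha> \<beta> Vanishing"
| odd:
    "reduced v \<alpha> \<beta> \<Longrightarrow> \<not> isotropic v \<alpha> \<beta> \<Longrightarrow> v \<alpha> + v \<beta> < v 2 + v 2 \<Longrightarrow> odd_val (v \<alpha> + v \<beta>) \<Longrightarrow>
     has_gen_arf v \<alpha> \<beta> (Odd_class ((\<alpha> * \<beta>) +o videal v (v (\<alpha> * \<beta>))))"
| even:
    "reduced v \<alpha> \<beta> \<Longrightarrow> \<not> isotropic v \<alpha> \<beta> \<Longrightarrow> 0 < v \<alpha> + v \<beta> \<Longrightarrow> v \<alpha> + v \<beta> < v 2 + v 2 \<Longrightarrow>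
     even_val (v \<alpha> + v \<beta>) \<Longrightarrow>
     has_gen_arf v \<alpha> \<beta> (Even_class ((\<alpha> * \<beta>) +o J_set v (v (\<alpha> * \<beta>))))"
| exact:
    "reduced v \<alpha> \<beta> \<Longrightarrow> \<not> isotropic v \<alpha> \<beta> \<Longrightarrow> v \<alpha> + v \<beta> = v 2 + v 2 \<Longrightarrow>
     has_gen_arf v \<alpha> \<beta> (Exact_class ((\<alpha> * \<beta>) +o (4 *o R_AS v)))"

definition is_gen_arf ::
  "('k::field \<Rightarrow> 'g::linordered_ab_group_add extended) \<Rightarrow> 'k gen_arf \<Rightarrow> bool" where
  "is_gen_arf v \<eta> \<longleftrightarrow> (\<exists>\<alpha> \<beta>. has_gen_arf v \<alpha> \<beta> \<eta>)"

definition gen_arf_val ::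
  "('k::field \<Rightarrow> 'g::linordered_ab_group_add extended) \<Rightarrow> 'k gen_arf \<Rightarrow> 'g extended" where
  "gen_arf_val v \<eta> =
     (if \<eta> = Vanishing then \<infinity> else (THE u. \<exists>\<alpha> \<beta>. has_gen_arf v \<alpha> \<beta> \<eta> \<and> u = v (\<alpha> * \<beta>)))"

primrec representatives :: "'k::zero gen_arf \<Rightarrow> 'k set" where
  "representatives Vanishing = {0}"
| "representatives (Odd_class C) = C"
| "representatives (Even_class C) = C"
| "representatives (Exact_class C) = C"


section \<open>Fine Arf invariants\<close>

definition S_set :: "('k::field \<Rightarrow> 'g::linordered_ab_group_add extended) \<Rightarrow> 'k set" where
  "S_set v = {t\<^sup>2 - 2 * t | t. t \<in> vring v \<and> v t + v t > v 2}"

definition fine_arf ::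
  "('k::field \<Rightarrow> 'g::linordered_ab_group_add extended) \<Rightarrow> 'k \<Rightarrow> 'k \<Rightarrow> 'k set" where
  "fine_arf v \<alpha> \<beta> = {w \<in> (\<alpha> * \<beta>) +o S_set v. v w = v (\<alpha> * \<beta>)}"


section \<open>Classes of minimal norms\<close>

definition unit_squares :: "('k::field \<Rightarrow> 'g::linordered_ab_group_add extended) \<Rightarrow> 'k set" where
  "unit_squares v = (\<lambda>c. c\<^sup>2) ` vunits v"

definition norm_group ::
  "('k::field \<Rightarrow> 'g::linordered_ab_group_add extended) \<Rightarrow> 'k \<Rightarrow> 'k set" where
  "norm_group v \<tau> = unit_squares v * (1 +o ((4 / \<tau>) *o R_AS v))"

definition norm_group_of ::
  "('k::field \<Rightarrow> 'g::linordered_ab_group_add extended) \<Rightarrow> 'k gen_arf \<Rightarrow> 'k set" where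
  "norm_group_of v \<eta> = (THE G. \<exists>\<tau>\<in>representatives \<eta>. G = norm_group v \<tau>)"

text \<open>
  A coarse class is an orbit of unit squares on \<open>R / 2R\<close>, hence a set of cosets of \<open>2R\<close>;
  a fine class is an orbit in \<open>R\<close>.
\<close>

datatype 'k norm_class = Coarse "'k set set" | Fine "'k set"

text \<open>Meaningful only for \<open>v \<beta> \<ge> v 2\<close> and \<open>\<eta>\<close> the generalized Arf invariant of the lattice.\<close>

definition min_norm_class ::
  "('k::field \<Rightarrow> 'g::linordered_ab_group_add extended) \<Rightarrow> 'k gen_arf \<Rightarrow> 'k \<Rightarrow> 'k \<Rightarrow> 'k norm_class" where
  "min_norm_class v \<eta> \<alpha> \<beta> =
     (if v \<beta> > v 2 then Coarse ((\<lambda>c. (c * \<alpha>) +o (2 *o vring v)) ` unit_squares v)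
      else Fine (\<alpha> *o norm_group_of v \<eta>))"

end

theory Submission
  imports Defs
begin

text \<open>
  Write \<open>R\<close> for the valuation ring, \<open>I\<close> for its maximal ideal and \<open>U\<close> for its units, and
  \<open>q(a, b) = \<alpha> a\<^sup>2 + 2 a b + \<beta> b\<^sup>2\<close> for the norm of \<open>a x + b y\<close>. Comparisons of values are
  turned into statements about quotients (\<open>v x \<le> v y\<close> iff \<open>y / x \<in> R\<close>), so that the
  argument takes place in \<open>R\<close> and its fraction field.

  The norm group. Put \<open>\<kappa> = 4 / \<tau>\<close>. The elements of \<open>norm_group v \<tau>\<close> are the values
  \<open>u\<^sup>2 + \<kappa> (u s + s\<^sup>2)\<close> with \<open>u\<close> a unit; these are norms from the quadratic
  algebra generated by \<open>\<omega>\<close> with \<open>\<omega>\<^sup>2 = \<kappa> \<omega> - \<kappa>\<close>. As long as no such value falls into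
  \<open>I\<close> (automatic for \<open>\<kappa> \<in> I\<close>, and provided by anisotropy of the lattice if \<open>\<kappa>\<close> is a unit),
  the group consists of all unit norms, hence it is
  closed under products and inverses. It does not depend on the representative \<open>\<tau>\<close> because
  each of the moves between representatives can be absorbed:

  \<^item> \<open>\<tau>\<close> to \<open>\<tau>(1 + h)\<close> with \<open>h \<in> I\<close>: the map \<open>t \<mapsto> t\<^sup>2 - t\<close> has derivative \<open>-1\<close> modulo \<open>I\<close>, so a
    perturbation of \<open>t\<^sup>2 - t\<close> by an element of \<open>I\<close> is compensated by changing \<open>t\<close>
    (\<open>norm_group_near_eq\<close>);
  \<^item> \<open>\<tau>\<close> to \<open>\<tau> + b\<^sup>2\<close>, in the even case: substitute \<open>c + b d\<close> for \<open>c\<close> in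
    \<open>c\<^sup>2 + 2 c d + \<tau> d\<^sup>2\<close>; the error terms lie in \<open>\<kappa> I\<close> (\<open>norm_group_add_square_eq\<close>);
  \<^item> \<open>\<tau>\<close> to \<open>\<tau> + 4(p\<^sup>2 - p)\<close>, in the exact case: substitute \<open>u - p s\<close> for \<open>u\<close> in
    \<open>u\<^sup>2 + u s + (\<tau>/4) s\<^sup>2\<close> (\<open>norm_group_add_4AS_subset\<close>).

  Maximality of \<open>v \<beta>\<close> and anisotropy guarantee that all representatives have the value of
  \<open>\<alpha> \<beta>\<close>, so that these moves apply (\<open>representative_facts\<close>).

  The classification. Isomorphisms are matrices of unit determinant \<open>D\<close> that transform one
  form into the other, and comparing Gram determinants gives
  \<open>1 - \<gamma> \<delta> = D\<^sup>2 (1 - \<alpha> \<beta>)\<close>. For products of the same value above \<open>v 2\<close> the fine Arf invariant is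
  precisely the class of \<open>1 - \<alpha> \<beta>\<close> modulo squares of units, because \<open>t\<^sup>2 - 2 t = (1 - t)\<^sup>2 - 1\<close>
  and because \<open>1 + 4 I\<close> consists of squares (\<open>diff_S_set_iff\<close>). The class of minimal norms
  says which \<open>\<gamma>\<close> occur as \<open>q(a, b)\<close> with \<open>a\<close> a unit: completing the square, this is
  \<open>\<gamma> / \<alpha> \<in> norm_group v (\<alpha> \<beta>)\<close> if \<open>v \<beta> = v 2\<close>, and \<open>\<gamma> \<in> U\<^sup>2 \<alpha> + 2 R\<close> if \<open>v \<beta> > v 2\<close>, where the
  equation for \<open>b\<close> is solved by Hensel's lemma. Both invariants are therefore preserved by
  isomorphisms; a vector with non-unit \<open>a\<close> is handled by a reflection or by a valuation
  argument. Conversely, once \<open>x'\<close> of norm \<open>\<gamma>\<close> is found, the vectors that complete it to a basis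
  and pair to \<open>1\<close> with it have the form \<open>p x' + r y'\<close> with \<open>p \<gamma> + r = 1\<close>. Equality of the fine
  Arf invariants dictates \<open>r\<close>, and a valuation estimate shows that \<open>p = (1 - r) / \<gamma>\<close> is
  integral (\<open>base_change_of_norm\<close>).
\<close>

section \<open>Arithmetic in the valuation ring\<close>

locale dyadic_henselian =
  fixes v :: "'k::field \<Rightarrow> 'g::linordered_ab_group_add extended"
  assumes valuation: "valuation v"
    and henselian: "two_henselian v"
    and two_pos: "v 2 > 0"
begin

abbreviation "R \<equiv> vring v"
abbreviation "I \<equiv> videal v 0"
abbreviation "U \<equiv> vunits v"

lemma v_zero [simp]: "v 0 = \<infinity>"
  using valuation by (simp add: valuation_def)

lemma v_FinE:
  assumes "x \<noteq> 0" obtains g where "v x = Fin g"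
  using valuation assms unfolding valuation_def by blast

lemma v_mult: "v (x * y) = v x + v y"
proof (cases "x = 0 \<or> y = 0")
  case True
  then show ?thesis
    by (cases "x = 0"; cases "y = 0"; metis v_FinE v_zero mult_zero_left mult_zero_right plus_extended.simps(2,3,4))
next
  case False
  then show ?thesis using valuation by (simp add: valuation_def)
qed

lemma v_add: "min (v x) (v y) \<le> v (x + y)"
  using valuation by (simp add: valuation_def)

lemma v_one [simp]: "v 1 = 0"
proof -
  obtain g where g: "v 1 = Fin g" by (rule v_FinE[of 1]) auto
  then have "g + g = g" using v_mult[of 1 1] by simp
  then show ?thesis by (simp add: g zero_extended_def)
qed

lemma two_nonzero [simp]: "(2::'k) \<noteq> 0"
  using henselian by (simp add: two_henselian_def)

lemma four_nonzero [simp]: "(4::'k) \<noteq> 0"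
proof -
  have "(4::'k) = 2 * 2" by simp
  then show ?thesis by (metis mult_eq_0_iff two_nonzero)
qed

text \<open>
  Every comparison of values becomes a membership of a quotient. This is what allows the rest
  of the development to argue with \<open>R\<close>, \<open>I\<close> and \<open>U\<close> instead of computing in the value group.
\<close>

lemma v_compare_divide:
  assumes "x \<noteq> 0"
  shows "v x \<le> v y \<longleftrightarrow> y / x \<in> R" and "v x < v y \<longleftrightarrow> y / x \<in> I" and "v y = v x \<longleftrightarrow> y / x \<in> U"
proof -
  obtain g where g: "v x = Fin g" using assms by (rule v_FinE)
  have *: "v y = v (y / x) + Fin g" using v_mult[of "y / x" x] assms g by simp
  have le: "v x \<le> v y \<longleftrightarrow> y / x \<in> R" and less: "v x < v y \<longleftrightarrow> y / x \<in> I"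
    and eq: "v y = v x \<longleftrightarrow> v (y / x) = 0" for y
    using v_mult[of "y / x" x] assms g
    by (cases "v (y / x)"; simp add: vring_def videal_def zero_extended_def)+
  have "z \<in> U \<longleftrightarrow> v z = 0" for z
  proof
    assume z: "z \<in> U"
    then obtain b where b: "b \<in> R" "z * b = 1" and zR: "z \<in> R" unfolding vunits_def by auto
    from b have "z \<noteq> 0" "b \<noteq> 0" by auto
    then obtain h k where "v z = Fin h" "v b = Fin k" by (meson v_FinE)
    then show "v z = 0" using zR b v_mult[of z b]
      by (simp add: vring_def zero_extended_def) (metis add.commute add_nonneg_eq_0_iff)
  next
    assume z: "v z = 0"
    then have nz: "z \<noteq> 0" by (auto simp: zero_extended_def)
    then obtain h where "v (1 / z) = Fin h" by (meson v_FinE divide_eq_0_iff one_neq_zero)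
    then have "v (1 / z) = 0" using v_mult[of z "1 / z"] z nz by (simp add: zero_extended_def)
    then show "z \<in> U" unfolding vunits_def vring_def using z nz
      by (auto intro!: exI[of _ "1 / z"])
  qed
  then show "v x \<le> v y \<longleftrightarrow> y / x \<in> R" "v x < v y \<longleftrightarrow> y / x \<in> I" "v y = v x \<longleftrightarrow> y / x \<in> U"
    using le less eq by auto
qed

lemma U_iff: "x \<in> U \<longleftrightarrow> x \<in> R \<and> x \<notin> I"
  using v_compare_divide[of 1 x] by auto

lemma v_unit_iff: "v x = 0 \<longleftrightarrow> x \<in> U"
  using v_compare_divide(3)[of 1 x] by auto

lemma v_unit_mult:
  assumes "u \<in> U" shows "v (u * x) = v x"
  using assms by (metis v_mult v_unit_iff add_0)

lemma R_I [intro]: "x \<in> I \<Longrightarrow> x \<in> R"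
  by (auto simp: vring_def videal_def)

lemma R_U [intro]: "x \<in> U \<Longrightarrow> x \<in> R"
  by (simp add: U_iff)

lemma R_uminus [simp, intro]: "x \<in> R \<Longrightarrow> - x \<in> R"
  and I_uminus [simp, intro]: "x \<in> I \<Longrightarrow> - x \<in> I"
proof -
  have "v (- 1) = 0"
  proof -
    obtain g where g: "v (- 1) = Fin g" by (rule v_FinE[of "- 1"]) auto
    then have "g + g = 0" using v_mult[of "- 1" "- 1"] by (simp add: zero_extended_def)
    then show ?thesis by (simp add: g zero_extended_def)
  qed
  then have "v (- x) = v x" using v_mult[of "- 1" x] by simp
  then show "x \<in> R \<Longrightarrow> - x \<in> R" "x \<in> I \<Longrightarrow> - x \<in> I" by (auto simp: vring_def videal_def)
qed

lemma R_0 [simp, intro]: "0 \<in> R" and R_1 [simp, intro]: "1 \<in> R"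
  by (auto simp: vring_def)

lemma I_0 [simp, intro]: "0 \<in> I"
  by (auto simp: videal_def zero_extended_def)

lemma R_add [simp, intro]: "x \<in> R \<Longrightarrow> y \<in> R \<Longrightarrow> x + y \<in> R"
  using v_add[of x y] by (auto simp: vring_def min_def split: if_splits)

lemma I_add [simp, intro]: "x \<in> I \<Longrightarrow> y \<in> I \<Longrightarrow> x + y \<in> I"
  using v_add[of x y] by (auto simp: videal_def min_def split: if_splits)

lemma R_diff [simp, intro]: "x \<in> R \<Longrightarrow> y \<in> R \<Longrightarrow> x - y \<in> R"
  using R_add[of x "- y"] by auto

lemma I_diff [simp, intro]: "x \<in> I \<Longrightarrow> y \<in> I \<Longrightarrow> x - y \<in> I"
  using I_add[of x "- y"] by auto

lemma R_mult [simp, intro]: "x \<in> R \<Longrightarrow> y \<in> R \<Longrightarrow> x * y \<in> R"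
  using v_mult[of x y]
  by (cases "v x"; cases "v y") (auto simp: vring_def zero_extended_def)

lemma I_mult_left [simp, intro]: "x \<in> R \<Longrightarrow> y \<in> I \<Longrightarrow> x * y \<in> I"
  using v_mult[of x y]
  by (cases "v x"; cases "v y") (auto simp: vring_def videal_def zero_extended_def intro: add_nonneg_pos)

lemma I_mult_right [simp, intro]: "x \<in> I \<Longrightarrow> y \<in> R \<Longrightarrow> x * y \<in> I"
  using I_mult_left[of y x] by (simp add: mult.commute)

lemma R_power [simp, intro]: "x \<in> R \<Longrightarrow> x ^ n \<in> R"
  by (induction n) auto

lemma R_of_nat: "of_nat n \<in> R"
  by (induction n) auto

lemma R_numeral [simp, intro]: "numeral n \<in> R"
  using R_of_nat[of "numeral n"] by simp

lemma two_I [simp, intro]: "2 \<in> I"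
  using two_pos by (simp add: videal_def)

lemma four_I [simp, intro]: "4 \<in> I"
  using I_mult_left[of 2 2] by simp

lemma U_nonzero [dest]: "x \<in> U \<Longrightarrow> x \<noteq> 0"
  by (auto simp: U_iff)

lemma U_1 [simp, intro]: "1 \<in> U"
  by (simp add: v_unit_iff[symmetric])

lemma U_uminus [intro]: "x \<in> U \<Longrightarrow> - x \<in> U"
  using I_uminus[of "- x"] by (auto simp: U_iff)

lemma U_mult [intro]: "x \<in> U \<Longrightarrow> y \<in> U \<Longrightarrow> x * y \<in> U"
  by (metis v_unit_iff v_unit_mult)

lemma U_divide [intro]: "x \<in> U \<Longrightarrow> y \<in> U \<Longrightarrow> x / y \<in> U"
  by (metis v_unit_iff v_compare_divide(3) U_nonzero)

lemma U_power [intro]: "x \<in> U \<Longrightarrow> x ^ n \<in> U"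
  by (induction n) auto

lemma R_divide_U [intro]: "x \<in> R \<Longrightarrow> y \<in> U \<Longrightarrow> x / y \<in> R"
  using R_mult[OF _ R_U[OF U_divide[OF U_1]], of x y] by simp

lemma I_divide_U [intro]: "x \<in> I \<Longrightarrow> y \<in> U \<Longrightarrow> x / y \<in> I"
  using I_mult_right[OF _ R_U[OF U_divide[OF U_1]], of x y] by simp

lemma U_add_I [intro]: "x \<in> U \<Longrightarrow> y \<in> I \<Longrightarrow> x + y \<in> U"
  using I_diff[of "x + y" y] by (auto simp: U_iff)

lemma U_diff_I [intro]: "x \<in> U \<Longrightarrow> y \<in> I \<Longrightarrow> x - y \<in> U"
  using U_add_I[of x "- y"] by auto

lemma R_dichotomy: "x \<in> R \<or> 1 / x \<in> I"
proof (cases "x = 0")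
  case False
  then have "v 1 \<le> v x \<longleftrightarrow> x \<in> R" "v x < v 1 \<longleftrightarrow> 1 / x \<in> I"
    using v_compare_divide(1)[of 1 x] v_compare_divide(2)[of x 1] by simp_all
  then show ?thesis by (meson linorder_not_le)
qed auto

text \<open>
  \<open>R\<close> is integrally closed: if \<open>x \<notin> R\<close>, then \<open>1 / x \<in> I\<close> and \<open>1 = x\<^sup>2 (1 / x) (1 / x) \<in> I\<close>.
  In this form the lemma replaces halving of values, which need not be possible in the value
  group.
\<close>

lemma R_square: "x\<^sup>2 \<in> R \<Longrightarrow> x \<in> R"
proof -
  assume x: "x\<^sup>2 \<in> R"
  have "x \<in> R" if "1 / x \<in> I"
  proof -
    have "1 = (x\<^sup>2 * (1 / x)) * (1 / x)" if "x \<noteq> 0" using that by (simp add: power2_eq_square)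
    moreover have "(x\<^sup>2 * (1 / x)) * (1 / x) \<in> I" using x that by blast
    ultimately show ?thesis using U_iff[of 1] by (cases "x = 0") auto
  qed
  then show "x \<in> R" using R_dichotomy by blast
qed

lemma I_square: "x\<^sup>2 \<in> I \<Longrightarrow> x \<in> I"
  using R_square[of x] U_power[of x 2] by (auto simp: U_iff)

section \<open>Quadratic Hensel lifting\<close>

lemma hensel:
  assumes "p \<in> R" "q \<in> R" "a \<in> R" "a\<^sup>2 + p * a + q \<in> I" "2 * a + p \<in> U"
  obtains b where "b \<in> R" "b\<^sup>2 + p * b + q = 0" "b - a \<in> I"
proof -
  let ?f = "[:q, p, 1:]"
  have c: "coeff ?f i \<in> vring v" for i
    using assms by (auto simp: coeff_pCons split: nat.splits)
  have f: "poly ?f a = a\<^sup>2 + p * a + q" and f': "poly (pderiv ?f) a = 2 * a + p" for a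
    by (simp_all add: algebra_simps power2_eq_square pderiv_pCons)
  then have "\<exists>b\<in>R. b\<^sup>2 + p * b + q = 0 \<and> b - a \<in> I"
    using henselian[unfolded two_henselian_def, THEN conjunct2, rule_format, of ?f a, OF c, unfolded f f']
      assms by (simp add: videal_def v_unit_iff)
  then show ?thesis using that by blast
qed

text \<open>
  The derivative \<open>2 r - 1\<close> of \<open>r\<^sup>2 - r\<close> is always a unit, so the lift starts from any \<open>s\<close>.
\<close>

lemma artin_schreier_lift:
  assumes "s \<in> R" "h \<in> I"
  obtains r where "r \<in> R" "r\<^sup>2 - r = s\<^sup>2 - s + h" "r - s \<in> I"
proof -
  have "s\<^sup>2 + (- 1) * s + (s - s\<^sup>2 - h) = - h" by (simp add: algebra_simps)
  then have 1: "s\<^sup>2 + (- 1) * s + (s - s\<^sup>2 - h) \<in> I" using assms by simp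
  have 2: "2 * s + (- 1) \<in> U" using U_uminus[OF U_diff_I[of 1 "2 * s"]] assms by simp
  have 3: "- 1 \<in> R" "s - s\<^sup>2 - h \<in> R" using assms by auto
  obtain r where r: "r \<in> R" "r\<^sup>2 + (- 1) * r + (s - s\<^sup>2 - h) = 0" "r - s \<in> I"
    using hensel[OF 3 assms(1) 1 2] by blast
  have "r\<^sup>2 - r = s\<^sup>2 - s + h" using r(2) by (simp add: algebra_simps)
  with r that show ?thesis by blast
qed

text \<open>
  With \<open>y = 1 - 2 u\<close> the equation \<open>y\<^sup>2 = 1 + c\<close> reads \<open>u\<^sup>2 - u = c / 4\<close>.
\<close>

lemma square_near_1:
  assumes "c / 4 \<in> I"
  obtains y where "y \<in> U" "y\<^sup>2 = 1 + c"
proof -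
  obtain u where u: "u \<in> R" "u\<^sup>2 - u = c / 4"
    using artin_schreier_lift[of 0 "c / 4"] assms by auto
  have "(1 - 2 * u)\<^sup>2 = 1 + 4 * (u\<^sup>2 - u)" by (simp add: power2_eq_square algebra_simps)
  then have "(1 - 2 * u)\<^sup>2 = 1 + c" using u(2) by simp
  moreover have "1 - 2 * u \<in> U" using u by auto
  ultimately show ?thesis using that by blast
qed

section \<open>Norm groups\<close>

lemma R_ASI: "t \<in> R \<Longrightarrow> t\<^sup>2 - t \<in> R_AS v"
  unfolding R_AS_def by (rule imageI)

text \<open>
  \<open>t \<mapsto> t\<^sup>2 - t\<close> is additive only modulo \<open>2\<close>; the defect \<open>- 2 t s\<close> lies in \<open>I\<close> and is
  absorbed by lifting. The same holds for negation.
\<close>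

lemma R_AS_add:
  assumes "x \<in> R_AS v" "y \<in> R_AS v"
  shows "x + y \<in> R_AS v"
proof -
  obtain t s where ts: "t \<in> R" "s \<in> R" "x = t\<^sup>2 - t" "y = s\<^sup>2 - s"
    using assms by (auto simp: R_AS_def)
  obtain r where r: "r \<in> R" "r\<^sup>2 - r = (t + s)\<^sup>2 - (t + s) + (- (2 * (t * s)))"
    by (rule artin_schreier_lift[of "t + s" "- (2 * (t * s))"]) (use ts in auto)
  note r(2)
  also have "(t + s)\<^sup>2 - (t + s) + (- (2 * (t * s))) = x + y"
    unfolding ts by (simp add: power2_eq_square algebra_simps)
  finally have "r\<^sup>2 - r = x + y" .
  then show ?thesis using R_ASI[OF r(1)] by (simp only:)
qed

lemma R_AS_uminus:
  assumes "x \<in> R_AS v"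
  shows "- x \<in> R_AS v"
proof -
  obtain t where t: "t \<in> R" "x = t\<^sup>2 - t" using assms by (auto simp: R_AS_def)
  have xI: "- (2 * x) \<in> I" using t by blast
  obtain r where r: "r \<in> R" "r\<^sup>2 - r = t\<^sup>2 - t + (- (2 * x))"
    using artin_schreier_lift[of "t" "- (2 * x)"] xI t(1) by metis
  note r(2)
  also have "t\<^sup>2 - t + (- (2 * x)) = - x" unfolding t(2)[symmetric] by simp
  finally have "r\<^sup>2 - r = - x" .
  then show ?thesis using R_ASI[OF r(1)] by (simp only:)
qed

lemma norm_group_iff:
  "x \<in> norm_group v \<tau> \<longleftrightarrow> (\<exists>c\<in>U. \<exists>t\<in>R. x = c\<^sup>2 * (1 + 4 / \<tau> * (t\<^sup>2 - t)))"
  unfolding norm_group_def unit_squares_def R_AS_def set_times_def elt_set_plus_def elt_set_times_def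
  by blast

lemma norm_groupI:
  "c \<in> U \<Longrightarrow> t \<in> R \<Longrightarrow> c\<^sup>2 * (1 + 4 / \<tau> * (t\<^sup>2 - t)) \<in> norm_group v \<tau>"
  using norm_group_iff by blast

text \<open>
  The units among the norms of \<open>u + s \<omega>\<close>, where \<open>\<omega>\<^sup>2 = \<kappa> \<omega> - \<kappa>\<close>. In contrast to the elements of
  \<open>norm_group\<close> there is no restriction on \<open>u\<close>, which makes multiplicativity immediate.
\<close>

definition unit_norms :: "'k \<Rightarrow> 'k set" where
  "unit_norms \<kappa> = {n \<in> U. \<exists>u\<in>R. \<exists>s\<in>R. n = u\<^sup>2 + \<kappa> * (u * s + s\<^sup>2)}"

text \<open>
  Multiplicativity of the norm: the coefficients below are those of \<open>(u + s \<omega>)(p + q \<omega>)\<close>.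
\<close>

lemma unit_norms_mult:
  assumes "\<kappa> \<in> R" "m \<in> unit_norms \<kappa>" "n \<in> unit_norms \<kappa>"
  shows "m * n \<in> unit_norms \<kappa>"
proof -
  obtain u s p q where *: "u \<in> R" "s \<in> R" "p \<in> R" "q \<in> R" "m \<in> U" "n \<in> U"
    "m = u\<^sup>2 + \<kappa> * (u * s + s\<^sup>2)" "n = p\<^sup>2 + \<kappa> * (p * q + q\<^sup>2)"
    using assms unfolding unit_norms_def by blast
  have "m * n = (u * p - \<kappa> * s * q)\<^sup>2 + \<kappa> * ((u * p - \<kappa> * s * q) * (u * q + s * p + \<kappa> * s * q)
      + (u * q + s * p + \<kappa> * s * q)\<^sup>2)"
    unfolding *(7,8) by (simp add: power2_eq_square algebra_simps)
  moreover have "u * p - \<kappa> * s * q \<in> R" "u * q + s * p + \<kappa> * s * q \<in> R" "m * n \<in> U"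
    using * assms(1) by auto
  ultimately show ?thesis unfolding unit_norms_def by blast
qed

text \<open>
  \<open>1 / n = n / n\<^sup>2\<close>, and dividing by the square of a unit rescales \<open>u\<close> and \<open>s\<close>.
\<close>

lemma unit_norms_inverse:
  assumes "n \<in> unit_norms \<kappa>"
  shows "1 / n \<in> unit_norms \<kappa>"
proof -
  obtain u s where *: "u \<in> R" "s \<in> R" "n \<in> U" "n = u\<^sup>2 + \<kappa> * (u * s + s\<^sup>2)"
    using assms unfolding unit_norms_def by blast
  have "1 / n = (u\<^sup>2 + \<kappa> * (u * s + s\<^sup>2)) / n\<^sup>2"
    using * by (simp add: power2_eq_square flip: *(4))
  also have "\<dots> = (u / n)\<^sup>2 + \<kappa> * (u / n * (s / n) + (s / n)\<^sup>2)"
    using U_nonzero[OF *(3)] by (simp add: power2_eq_square field_simps)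
  finally have "1 / n = (u / n)\<^sup>2 + \<kappa> * (u / n * (s / n) + (s / n)\<^sup>2)" .
  moreover have "u / n \<in> R" "s / n \<in> R" "1 / n \<in> U" using * by auto
  ultimately show ?thesis unfolding unit_norms_def by blast
qed

text \<open>
  If \<open>u\<close> is a unit, dividing by \<open>u\<^sup>2\<close> gives \<open>1 + \<kappa> (t\<^sup>2 - t)\<close> with \<open>t = - s / u\<close>. If it is not,
  then \<open>\<kappa> s\<close> must be a unit, and the negative of conjugation, which is \<open>u \<mapsto> - u - \<kappa> s\<close> and
  keeps \<open>s\<close>, leads to an element of the same norm with a unit in first position.
\<close>

lemma unit_norms_subset_norm_group:
  assumes "4 / \<tau> \<in> R"
  shows "unit_norms (4 / \<tau>) \<subseteq> norm_group v \<tau>"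
proof
  fix n assume "n \<in> unit_norms (4 / \<tau>)"
  then obtain u s where n: "n \<in> U" "u \<in> R" "s \<in> R" "n = u\<^sup>2 + 4 / \<tau> * (u * s + s\<^sup>2)"
    unfolding unit_norms_def by blast
  define \<kappa> where "\<kappa> = 4 / \<tau>"
  have \<kappa>: "\<kappa> \<in> R" "n = u\<^sup>2 + \<kappa> * (u * s + s\<^sup>2)" using assms n by (simp_all add: \<kappa>_def)
  have main: "w\<^sup>2 + \<kappa> * (w * s + s\<^sup>2) \<in> norm_group v \<tau>" if "w \<in> U" for w
  proof -
    have "w\<^sup>2 + \<kappa> * (w * s + s\<^sup>2) = w\<^sup>2 * (1 + 4 / \<tau> * ((- s / w)\<^sup>2 - (- s / w)))"
      unfolding \<kappa>_def[symmetric] using U_nonzero[OF that]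
      by (simp add: power2_eq_square field_simps)
    moreover have "- s / w \<in> R" using R_divide_U[of "- s" w] n that by auto
    ultimately show ?thesis using norm_groupI[OF that] by metis
  qed
  show "n \<in> norm_group v \<tau>"
  proof (cases "u \<in> U")
    case True
    then show ?thesis using main \<kappa> by simp
  next
    case False
    then have u: "u \<in> I" using n U_iff by blast
    have "\<kappa> * s \<in> U"
    proof (rule ccontr)
      assume "\<kappa> * s \<notin> U"
      then have "\<kappa> * s \<in> I" using \<kappa> n U_iff by blast
      then have "u * u + (u * (\<kappa> * s) + (\<kappa> * s) * s) \<in> I" using u n by blast
      then have "n \<in> I" unfolding \<kappa> by (simp add: power2_eq_square algebra_simps)
      then show False using n U_iff by blast
    qed
    then have "- u - \<kappa> * s \<in> U" using U_diff_I[OF U_uminus u, of "\<kappa> * s"] by (simp only: minus_diff_commute)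
    moreover have "n = (- u - \<kappa> * s)\<^sup>2 + \<kappa> * ((- u - \<kappa> * s) * s + s\<^sup>2)"
      unfolding \<kappa>(2) by (simp add: power2_eq_square algebra_simps)
    ultimately show ?thesis using main by simp
  qed
qed

text \<open>
  The condition under which \<open>norm_group v \<tau>\<close> consists of units. It is automatic for
  \<open>4 / \<tau> \<in> I\<close>; if \<open>4 / \<tau>\<close> is a unit, it says that the norm form is anisotropic over the
  residue field.
\<close>

definition residually_anisotropic :: "'k \<Rightarrow> bool" where
  "residually_anisotropic \<tau> \<longleftrightarrow> \<tau> \<noteq> 0 \<and> 4 / \<tau> \<in> R \<and> (\<forall>t\<in>R. 1 + 4 / \<tau> * (t\<^sup>2 - t) \<in> U)"

lemma norm_group_eq_unit_norms:
  assumes "residually_anisotropic \<tau>"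
  shows "norm_group v \<tau> = unit_norms (4 / \<tau>)"
proof
  show "norm_group v \<tau> \<subseteq> unit_norms (4 / \<tau>)"
  proof
    fix x assume "x \<in> norm_group v \<tau>"
    then obtain c t where *: "c \<in> U" "t \<in> R" "x = c\<^sup>2 * (1 + 4 / \<tau> * (t\<^sup>2 - t))"
      using norm_group_iff by blast
    then have "x \<in> U" using assms unfolding residually_anisotropic_def by blast
    moreover have "x = c\<^sup>2 + 4 / \<tau> * (c * (- c * t) + (- c * t)\<^sup>2)"
      unfolding * by (simp add: power2_eq_square algebra_simps flip: add_divide_distrib)
    moreover have "- c * t \<in> R" using * by blast
    ultimately show "x \<in> unit_norms (4 / \<tau>)" unfolding unit_norms_def using *(1) by blast
  qed
  show "unit_norms (4 / \<tau>) \<subseteq> norm_group v \<tau>"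
    using assms unit_norms_subset_norm_group unfolding residually_anisotropic_def by blast
qed

text \<open>
  Because the norm group is a group, its orbits coincide as soon as they meet.
\<close>

lemma norm_group_coset_eq:
  assumes "residually_anisotropic \<tau>" "g \<in> norm_group v \<tau>"
  shows "(\<alpha> * g) *o norm_group v \<tau> = \<alpha> *o norm_group v \<tau>"
proof -
  let ?N = "norm_group v \<tau>"
  have mult: "m * n \<in> ?N" if "m \<in> ?N" "n \<in> ?N" for m n
    using that assms(1) unit_norms_mult unfolding norm_group_eq_unit_norms[OF assms(1)] residually_anisotropic_def
    by blast
  have inv: "1 / g \<in> ?N"
    using assms unit_norms_inverse norm_group_eq_unit_norms by simp
  have g0: "g \<noteq> 0"
    using assms unfolding norm_group_eq_unit_norms[OF assms(1)] unit_norms_def by blast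
  have "\<alpha> * g * n \<in> \<alpha> *o ?N" if "n \<in> ?N" for n
    using mult[OF assms(2) that] by (auto simp: elt_set_times_def mult.assoc)
  moreover have "\<alpha> * n \<in> (\<alpha> * g) *o ?N" if "n \<in> ?N" for n
    using mult[OF inv that] g0 unfolding elt_set_times_def
    by (intro CollectI bexI[of _ "1 / g * n"]) auto
  ultimately show ?thesis unfolding elt_set_times_def by blast
qed

section \<open>Changing the representative of a norm group\<close>

text \<open>
  A relative change of \<open>\<tau>\<close> by \<open>1 + I\<close> multiplies \<open>t\<^sup>2 - t\<close> by an element of \<open>1 + I\<close>, which
  a change of \<open>t\<close> makes up for.
\<close>

lemma norm_group_near_subset:
  assumes "\<tau> \<noteq> 0" "(\<tau>' - \<tau>) / \<tau> \<in> I"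
  shows "norm_group v \<tau>' \<subseteq> norm_group v \<tau>"
proof
  fix x assume "x \<in> norm_group v \<tau>'"
  then obtain c t where x: "c \<in> U" "t \<in> R" "x = c\<^sup>2 * (1 + 4 / \<tau>' * (t\<^sup>2 - t))"
    using norm_group_iff by blast
  have q: "\<tau>' / \<tau> \<in> U"
    using U_add_I[OF U_1 assms(2)] assms(1) by (simp add: diff_divide_distrib)
  then have \<tau>': "\<tau>' \<noteq> 0" by (auto dest: U_nonzero)
  have "((\<tau>' - \<tau>) / \<tau>) / (\<tau>' / \<tau>) \<in> I" using assms q by blast
  then have "(- (((\<tau>' - \<tau>) / \<tau>) / (\<tau>' / \<tau>))) * (t\<^sup>2 - t) \<in> I" using x by blast
  then obtain r where r: "r \<in> R"
    "r\<^sup>2 - r = t\<^sup>2 - t + (- (((\<tau>' - \<tau>) / \<tau>) / (\<tau>' / \<tau>))) * (t\<^sup>2 - t)"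
    using artin_schreier_lift[OF x(2)] by metis
  note r(2)
  also have "- (((\<tau>' - \<tau>) / \<tau>) / (\<tau>' / \<tau>)) = \<tau> / \<tau>' - 1"
    using assms(1) \<tau>' by (simp add: field_simps)
  finally have "r\<^sup>2 - r = (\<tau> / \<tau>') * (t\<^sup>2 - t)" by (simp add: algebra_simps)
  then have "4 / \<tau> * (r\<^sup>2 - r) = 4 / \<tau>' * (t\<^sup>2 - t)" using assms(1) \<tau>' by simp
  then show "x \<in> norm_group v \<tau>" using x norm_groupI[OF x(1) r(1), of \<tau>] by simp
qed

lemma norm_group_near_eq:
  assumes "\<tau> \<noteq> 0" "(\<tau>' - \<tau>) / \<tau> \<in> I"
  shows "norm_group v \<tau>' = norm_group v \<tau>"
proof
  have q: "\<tau>' / \<tau> \<in> U"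
    using U_add_I[OF U_1 assms(2)] assms(1) by (simp add: diff_divide_distrib)
  then have \<tau>': "\<tau>' \<noteq> 0" by (auto dest: U_nonzero)
  have "- (((\<tau>' - \<tau>) / \<tau>) / (\<tau>' / \<tau>)) \<in> I" using assms q by blast
  moreover have "- (((\<tau>' - \<tau>) / \<tau>) / (\<tau>' / \<tau>)) = (\<tau> - \<tau>') / \<tau>'"
    using assms(1) \<tau>' by (simp add: field_simps)
  ultimately show "norm_group v \<tau> \<subseteq> norm_group v \<tau>'"
    using norm_group_near_subset[OF \<tau>'] by simp
qed (rule norm_group_near_subset[OF assms])

text \<open>
  Put \<open>\<tau>' = \<tau> + b\<^sup>2\<close> and \<open>d = - 2 t / \<tau>'\<close>. Then
  \<open>1 + (4 / \<tau>')(t\<^sup>2 - t) = 1 + 2 d + \<tau>' d\<^sup>2\<close>, and with \<open>C = 1 + b d\<close> this equals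
  \<open>C\<^sup>2 + 2 C d + \<tau> d\<^sup>2 - 2 b d (1 + d)\<close>. The first three summands are \<open>C\<^sup>2\<close> times a value
  \<open>1 + (4 / \<tau>)(s\<^sup>2 - s)\<close>, and the last one is \<open>4 / \<tau>\<close> times an element of \<open>I\<close>, because
  \<open>b d \<in> I\<close> and \<open>b \<in> I\<close>.
\<close>

lemma norm_group_add_square_subset:
  assumes "\<tau> \<in> I" "\<tau> \<noteq> 0" "4 / \<tau> \<in> I" "b\<^sup>2 / \<tau> \<in> R" "(\<tau> + b\<^sup>2) / \<tau> \<in> U"
  shows "norm_group v (\<tau> + b\<^sup>2) \<subseteq> norm_group v \<tau>"
proof
  let ?\<tau> = "\<tau> + b\<^sup>2"
  fix x assume "x \<in> norm_group v ?\<tau>"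
  then obtain c t where x: "c \<in> U" "t \<in> R" "x = c\<^sup>2 * (1 + 4 / ?\<tau> * (t\<^sup>2 - t))"
    using norm_group_iff by blast
  have \<tau>': "?\<tau> \<noteq> 0" using assms(5) by (auto dest: U_nonzero)
  define e where "e = \<tau> / ?\<tau>"
  have e: "e \<in> U" "e * ?\<tau> = \<tau>"
    using U_divide[OF U_1 assms(5)] \<tau>' by (simp_all add: e_def)
  define d where "d = - (2 * t) / ?\<tau>"
  define C where "C = 1 + b * d"
  \<comment> \<open>\<open>b d\<close> is an integral multiple of \<open>2 b / \<tau>\<close>, whose square is seen to lie in \<open>I\<close>\<close>
  have "(2 * b / \<tau>)\<^sup>2 = 4 / \<tau> * (b\<^sup>2 / \<tau>)" by (simp add: power2_eq_square)
  then have "(2 * b / \<tau>)\<^sup>2 \<in> I" using assms by (metis I_mult_right)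
  then have "2 * b / \<tau> \<in> I" by (rule I_square)
  then have "- (e * t * (2 * b / \<tau>)) \<in> I" using e x by blast
  moreover have "b * d = - (e * t * (2 * b / \<tau>))"
    using \<tau>' assms(2) by (simp add: d_def e_def)
  ultimately have bd: "b * d \<in> I" by simp
  then have C: "C \<in> U" unfolding C_def by blast
  have "b\<^sup>2 = b\<^sup>2 / \<tau> * \<tau>" using assms(2) by simp
  then have "b\<^sup>2 \<in> I" using assms by (metis I_mult_left)
  then have b: "b \<in> I" by (rule I_square)
  define s where "s = e * t / C"
  define h where "h = e * t * (b + b * d) / C\<^sup>2"
  have "s \<in> R" unfolding s_def using e x C by blast
  moreover have "h \<in> I" unfolding h_def using e x C b bd by blast
  ultimately obtain r where r: "r \<in> R" "r\<^sup>2 - r = s\<^sup>2 - s + h"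
    using artin_schreier_lift by blast
  have C0: "C \<noteq> 0" using C by blast
  have "C\<^sup>2 * (s\<^sup>2 - s + h) = (e * t)\<^sup>2 - C * (e * t) + e * t * (b + b * d)"
    using C0 by (simp add: s_def h_def power2_eq_square field_simps)
  also have "\<dots> = (e * t) * (e * t - 1 + b)"
    by (simp add: C_def power2_eq_square algebra_simps)
  finally have 1: "C\<^sup>2 * (s\<^sup>2 - s + h) = (e * t) * (e * t - 1 + b)" .
  have be: "b\<^sup>2 / ?\<tau> = 1 - e"
    using \<tau>' by (simp add: e_def field_simps)
  have "C\<^sup>2 = 1 - 4 * t / ?\<tau> * b + 4 * t / ?\<tau> * (b\<^sup>2 / ?\<tau>) * t"
    by (simp add: C_def d_def power2_eq_square algebra_simps)
  then have C2: "C\<^sup>2 = 1 - 4 * t / ?\<tau> * b + 4 * t / ?\<tau> * (1 - e) * t"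
    unfolding be .
  have alg: "1 - k * b + k * (1 - e) * t + k * (e * t - 1 + b) = 1 + k * (t - 1)" for k
    by (simp add: algebra_simps)
  have "C\<^sup>2 * (1 + 4 / \<tau> * (r\<^sup>2 - r)) = C\<^sup>2 + 4 / \<tau> * (C\<^sup>2 * (s\<^sup>2 - s + h))"
    unfolding r(2) by (simp only: distrib_left mult_1_right mult.left_commute)
  also have "\<dots> = C\<^sup>2 + 4 / \<tau> * ((e * t) * (e * t - 1 + b))" unfolding 1 ..
  also have "4 / \<tau> * ((e * t) * (e * t - 1 + b)) = 4 * t / ?\<tau> * (e * t - 1 + b)"
    using assms(2) by (simp add: e_def)
  also have "C\<^sup>2 + \<dots> = 1 - 4 * t / ?\<tau> * b + 4 * t / ?\<tau> * (1 - e) * t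
      + 4 * t / ?\<tau> * (e * t - 1 + b)"
    unfolding C2 ..
  also have "\<dots> = 1 + 4 * t / ?\<tau> * (t - 1)" by (rule alg)
  also have "\<dots> = 1 + 4 / ?\<tau> * (t\<^sup>2 - t)"
    by (simp add: power2_eq_square algebra_simps)
  finally have "x = c\<^sup>2 * (C\<^sup>2 * (1 + 4 / \<tau> * (r\<^sup>2 - r)))"
    unfolding x(3) by (simp only:)
  then have "x = (c * C)\<^sup>2 * (1 + 4 / \<tau> * (r\<^sup>2 - r))"
    by (simp only: power_mult_distrib mult.assoc)
  then show "x \<in> norm_group v \<tau>" using norm_groupI[OF U_mult[OF x(1) C] r(1)] by simp
qed

text \<open>
  The converse inclusion applies the lemma again, with the same \<open>b\<close>:
  \<open>\<tau> + 2 b\<^sup>2\<close> is a relative change of \<open>\<tau>\<close> by \<open>1 + I\<close>, since \<open>2 \<in> I\<close>.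
\<close>

lemma norm_group_add_square_eq:
  assumes "\<tau> \<in> I" "\<tau> \<noteq> 0" "4 / \<tau> \<in> I" "b\<^sup>2 / \<tau> \<in> R" "(\<tau> + b\<^sup>2) / \<tau> \<in> U"
  shows "norm_group v (\<tau> + b\<^sup>2) = norm_group v \<tau>"
proof
  show "norm_group v (\<tau> + b\<^sup>2) \<subseteq> norm_group v \<tau>" by (rule norm_group_add_square_subset[OF assms])
  let ?\<tau> = "\<tau> + b\<^sup>2"
  define e where "e = \<tau> / ?\<tau>"
  have \<tau>': "?\<tau> \<noteq> 0" using assms(5) by (auto dest: U_nonzero)
  have e: "e \<in> U" "\<tau> = e * ?\<tau>"
    using U_divide[OF U_1 assms(5)] \<tau>' by (simp_all add: e_def)
  have "?\<tau> = \<tau> * (?\<tau> / \<tau>)" using assms(2) by simp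
  then have 1: "?\<tau> \<in> I" using assms by (metis I_mult_right R_U)
  have "4 / ?\<tau> = e * (4 / \<tau>)" using assms(2) by (simp add: e_def)
  then have 2: "4 / ?\<tau> \<in> I" using e assms(3) by (metis I_mult_left R_U)
  have "b\<^sup>2 / ?\<tau> = e * (b\<^sup>2 / \<tau>)" using assms(2) by (simp add: e_def)
  then have 3: "b\<^sup>2 / ?\<tau> \<in> R" using e assms(4) by (metis R_mult R_U)
  have "(?\<tau> + b\<^sup>2 - \<tau>) / \<tau> = 2 * (b\<^sup>2 / \<tau>)" by (simp add: field_simps)
  then have near: "(?\<tau> + b\<^sup>2 - \<tau>) / \<tau> \<in> I" using I_mult_right[OF two_I assms(4)] by simp
  have "1 + (?\<tau> + b\<^sup>2 - \<tau>) / \<tau> = (?\<tau> + b\<^sup>2) / \<tau>"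
    using assms(2) by (simp add: diff_divide_distrib add_divide_distrib)
  then have "(?\<tau> + b\<^sup>2) / ?\<tau> = e * (1 + (?\<tau> + b\<^sup>2 - \<tau>) / \<tau>)"
    using assms(2) by (simp add: e_def)
  then have 4: "(?\<tau> + b\<^sup>2) / ?\<tau> \<in> U" using U_mult[OF e(1) U_add_I[OF U_1 near]] by simp
  show "norm_group v \<tau> \<subseteq> norm_group v ?\<tau>"
    using norm_group_add_square_subset[OF 1 \<tau>' 2 3 4] norm_group_near_eq[OF assms(2) near] by simp
qed

text \<open>
  With \<open>\<theta> = \<tau> / 4\<close>, a unit, and \<open>S = s / \<theta>\<close> the norm is \<open>w\<^sup>2 + w S + \<theta> S\<^sup>2\<close>.
  Substituting \<open>w = u - p S\<close> gives \<open>u\<^sup>2 + (1 - 2 p) u S + (\<theta> + p\<^sup>2 - p) S\<^sup>2\<close>. Scaling \<open>S\<close> by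
  \<open>1 - 2 p\<close> normalizes the middle coefficient at the cost of dividing the last one by
  \<open>(1 - 2 p)\<^sup>2 \<in> 1 + I\<close>, which does not affect the norm group.
\<close>

lemma norm_group_add_4AS_subset:
  assumes "residually_anisotropic \<tau>" "p \<in> R" "4 / \<tau> \<in> U"
    and "4 / (\<tau> + 4 * (p\<^sup>2 - p)) \<in> U"
  shows "norm_group v \<tau> \<subseteq> norm_group v (\<tau> + 4 * (p\<^sup>2 - p))"
proof
  let ?\<tau> = "\<tau> + 4 * (p\<^sup>2 - p)"
  fix n assume "n \<in> norm_group v \<tau>"
  then obtain w s where n: "n \<in> U" "w \<in> R" "s \<in> R" "n = w\<^sup>2 + 4 / \<tau> * (w * s + s\<^sup>2)"
    unfolding norm_group_eq_unit_norms[OF assms(1)] unit_norms_def by blast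
  have nz: "\<tau> \<noteq> 0" "?\<tau> \<noteq> 0" using U_nonzero[OF assms(3)] U_nonzero[OF assms(4)] by auto
  define D where "D = 1 - 2 * p"
  have D: "D \<in> U" unfolding D_def using assms(2) by blast
  then have D0: "D \<noteq> 0" by blast
  define \<sigma> where "\<sigma> = ?\<tau> / D\<^sup>2"
  have \<sigma>0: "\<sigma> \<noteq> 0" using nz D0 by (simp add: \<sigma>_def)
  have "4 / \<sigma> = 4 / ?\<tau> * D\<^sup>2" by (simp add: \<sigma>_def)
  then have \<sigma>U: "4 / \<sigma> \<in> U" using U_mult[OF assms(4) U_power[OF D, of 2]] by simp
  have "(\<sigma> - ?\<tau>) / ?\<tau> = 1 / D\<^sup>2 - 1" using nz(2) D0 unfolding \<sigma>_def diff_divide_distrib by simp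
  also have "\<dots> = (1 - D\<^sup>2) / D\<^sup>2" using D0 by (simp add: diff_divide_distrib)
  also have "1 - D\<^sup>2 = - (4 * (p\<^sup>2 - p))" by (simp add: D_def power2_eq_square algebra_simps)
  also have "- (4 * (p\<^sup>2 - p)) / D\<^sup>2 = - (4 * (p\<^sup>2 - p) / D\<^sup>2)" by (simp only: minus_divide_left)
  also have "\<dots> \<in> I" using D assms(2) by blast
  finally have near: "norm_group v \<sigma> = norm_group v ?\<tau>" by (rule norm_group_near_eq[OF nz(2)])
  define S where "S = 4 / \<tau> * s"
  define u where "u = w + p * S"
  have S: "S \<in> R" unfolding S_def using n assms(3) by blast
  have u: "u \<in> R" unfolding u_def using S n assms(2) by blast
  define q where "q = D * S / (4 / \<sigma>)"
  have q: "q \<in> R" unfolding q_def using \<sigma>U S D by blast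
  have "n = w\<^sup>2 + w * S + \<tau> / 4 * S\<^sup>2"
    using nz by (simp add: n(4) S_def power2_eq_square field_simps)
  also have "\<dots> = u\<^sup>2 + u * (D * S) + ?\<tau> / 4 * S\<^sup>2"
    by (simp add: u_def D_def power2_eq_square field_simps)
  also have "\<dots> = u\<^sup>2 + u * (D * S) + \<sigma> / 4 * (D * S)\<^sup>2"
    using D0 by (simp add: \<sigma>_def power_mult_distrib)
  also have "\<dots> = u\<^sup>2 + 4 / \<sigma> * (u * q + q\<^sup>2)"
  proof -
    have "k * (u * (X / k) + (X / k)\<^sup>2) = u * X + X\<^sup>2 / k" if "k \<noteq> 0" for k X :: 'k
      using that by (simp add: distrib_left power2_eq_square)
    from this[of "4 / \<sigma>" "D * S"] show ?thesis using \<sigma>0 by (simp add: q_def)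
  qed
  finally have "n \<in> unit_norms (4 / \<sigma>)" unfolding unit_norms_def using n(1) u q by blast
  then show "n \<in> norm_group v ?\<tau>"
    using unit_norms_subset_norm_group \<sigma>U near by blast
qed

lemma residually_anisotropicI: "\<tau> \<noteq> 0 \<Longrightarrow> 4 / \<tau> \<in> I \<Longrightarrow> residually_anisotropic \<tau>"
  unfolding residually_anisotropic_def by blast

lemma residually_anisotropicI_units:
  assumes "\<tau> / 4 \<in> U" "\<And>t. t \<in> R \<Longrightarrow> \<tau> / 4 + (t\<^sup>2 - t) \<in> U"
  shows "residually_anisotropic \<tau>"
proof -
  have 0: "\<tau> \<noteq> 0" using assms(1) by auto
  have "1 + 4 / \<tau> * (t\<^sup>2 - t) = (\<tau> / 4 + (t\<^sup>2 - t)) / (\<tau> / 4)" for t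
    using 0 by (simp add: field_simps)
  moreover have "4 / \<tau> = 1 / (\<tau> / 4)" by simp
  ultimately show ?thesis unfolding residually_anisotropic_def
    using 0 assms U_divide R_U U_1 by metis
qed

section \<open>Representatives of generalized Arf invariants\<close>

text \<open>
  If, say, \<open>c\<close> is a unit and \<open>r w = s (a, c)\<close>, then \<open>w\<close> is the multiple of \<open>(a, c)\<close> by
  \<open>snd w / c\<close>.
\<close>

lemma primitiveI:
  assumes "a \<in> R" "c \<in> R" "a \<in> U \<or> c \<in> U"
  shows "primitive v (a, c)"
proof -
  have main: "w \<in> (\<lambda>s. mscale s (a, c)) ` R"
    if w: "w \<in> mcarrier v" and r: "r \<in> R" "r \<noteq> 0" and s: "s \<in> R" "mscale r w = mscale s (a, c)" for w r s
  proof -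
    obtain p q where pq: "w = (p, q)" by (cases w)
    have *: "p \<in> R" "q \<in> R" "r * p = s * a" "r * q = s * c"
      using w s pq by (auto simp: mcarrier_def mscale_def)
    have "\<exists>k\<in>R. p = k * a \<and> q = k * c"
    proof (cases "a \<in> U")
      case True
      then have "r * q = r * (p / a * c)" using * U_nonzero[OF True] by (simp add: field_simps)
      then have "q = p / a * c" using r(2) by (metis mult_left_cancel)
      then show ?thesis using True * U_nonzero[OF True] by (intro bexI[of _ "p / a"]) auto
    next
      case False
      then have c: "c \<in> U" using assms(3) by simp
      then have "r * p = r * (q / c * a)" using * U_nonzero[OF c] by (simp add: field_simps)
      then have "p = q / c * a" using r(2) by (metis mult_left_cancel)
      then show ?thesis using c * U_nonzero[OF c] by (intro bexI[of _ "q / c"]) auto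
    qed
    then show ?thesis unfolding pq by (auto simp: mscale_def)
  qed
  have "(a, c) \<noteq> 0" using assms(3) by (auto simp: zero_prod_def dest: U_nonzero)
  then show ?thesis using assms(1,2) main unfolding primitive_def by (auto simp: mcarrier_def)
qed

lemma anisotropic_nonzero:
  assumes "\<not> isotropic v \<alpha> \<beta>"
  shows "\<alpha> \<noteq> 0" "\<beta> \<noteq> 0"
proof -
  have "(1, 0) \<in> mcarrier v" "(0, 1) \<in> mcarrier v" by (auto simp: mcarrier_def)
  then show "\<alpha> \<noteq> 0" "\<beta> \<noteq> 0" using assms unfolding isotropic_def
    by (force simp: mform_def zero_prod_def)+
qed

text \<open>
  Here maximality of \<open>v \<beta>\<close> enters. If \<open>\<alpha> \<beta> + b\<^sup>2\<close> had a larger value than \<open>\<alpha> \<beta>\<close>, then the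
  primitive vector \<open>(b / \<alpha>, 1)\<close> of norm \<open>(\<alpha> \<beta> + b\<^sup>2 + 2 b) / \<alpha>\<close> would have a norm of larger
  value than \<open>\<beta>\<close>. So \<open>\<alpha> \<beta>\<close> is not an approximate square, and all representatives of an even
  invariant have the same value.
\<close>

lemma add_square_unit:
  assumes red: "reduced v \<alpha> \<beta>" and nz: "\<alpha> \<noteq> 0" "\<beta> \<noteq> 0"
    and small: "4 / (\<alpha> * \<beta>) \<in> I" and b: "b\<^sup>2 / (\<alpha> * \<beta>) \<in> R"
  shows "(\<alpha> * \<beta> + b\<^sup>2) / (\<alpha> * \<beta>) \<in> U"
proof (rule ccontr)
  assume notU: "(\<alpha> * \<beta> + b\<^sup>2) / (\<alpha> * \<beta>) \<notin> U"
  have "(\<alpha> * \<beta> + b\<^sup>2) / (\<alpha> * \<beta>) = 1 + b\<^sup>2 / (\<alpha> * \<beta>)"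
    using nz by (simp add: add_divide_distrib)
  then have "(\<alpha> * \<beta> + b\<^sup>2) / (\<alpha> * \<beta>) \<in> R" using b by simp
  then have 1: "(\<alpha> * \<beta> + b\<^sup>2) / (\<alpha> * \<beta>) \<in> I" using notU U_iff by blast
  have "(2 * b / (\<alpha> * \<beta>))\<^sup>2 = 4 / (\<alpha> * \<beta>) * (b\<^sup>2 / (\<alpha> * \<beta>))" by (simp add: power2_eq_square)
  then have "(2 * b / (\<alpha> * \<beta>))\<^sup>2 \<in> I" using small b by (metis I_mult_right)
  then have 2: "2 * b / (\<alpha> * \<beta>) \<in> I" by (rule I_square)
  have R: "\<alpha> \<in> R" "\<beta> \<in> R" "\<beta> / \<alpha> \<in> R"
    using red v_compare_divide(1)[OF nz(1), of \<beta>] unfolding reduced_def by auto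
  have "(b / \<alpha>)\<^sup>2 = b\<^sup>2 / (\<alpha> * \<beta>) * (\<beta> / \<alpha>)" using nz by (simp add: power2_eq_square)
  then have "b / \<alpha> \<in> R" using R b by (metis R_mult R_square)
  then have "primitive v (b / \<alpha>, 1)" by (intro primitiveI) auto
  then have "v (mform \<alpha> \<beta> (b / \<alpha>, 1) (b / \<alpha>, 1)) \<le> v \<beta>"
    using red unfolding reduced_def maximal_valuation_def by blast
  then have 3: "mform \<alpha> \<beta> (b / \<alpha>, 1) (b / \<alpha>, 1) / \<beta> \<notin> I"
    using v_compare_divide(2)[OF nz(2)] by (metis linorder_not_le)
  have "mform \<alpha> \<beta> (b / \<alpha>, 1) (b / \<alpha>, 1) / \<beta> = (\<alpha> * \<beta> + b\<^sup>2) / (\<alpha> * \<beta>) + 2 * b / (\<alpha> * \<beta>)"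
    using nz by (simp add: mform_def power2_eq_square field_simps)
  then show False using 1 2 3 by (metis I_add)
qed

text \<open>
  Here anisotropy enters. If the element were in \<open>I\<close>, then \<open>X\<^sup>2 - X + \<alpha> \<beta> / 4\<close> would
  have a root \<open>X\<close> by lifting \<open>t\<close>, and \<open>(- 2 X / \<alpha>, 1)\<close> would be isotropic.
\<close>

lemma exact_unit:
  assumes red: "reduced v \<alpha> \<beta>" and an: "\<not> isotropic v \<alpha> \<beta>"
    and \<theta>: "\<alpha> * \<beta> / 4 \<in> U" and t: "t \<in> R"
  shows "\<alpha> * \<beta> / 4 + (t\<^sup>2 - t) \<in> U"
proof (rule ccontr)
  assume notU: "\<alpha> * \<beta> / 4 + (t\<^sup>2 - t) \<notin> U"
  note nz = anisotropic_nonzero[OF an]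
  have "\<alpha> * \<beta> / 4 + (t\<^sup>2 - t) \<in> R" using \<theta> t by blast
  then have "\<alpha> * \<beta> / 4 + (t\<^sup>2 - t) \<in> I" using notU U_iff by blast
  then obtain X where X: "X \<in> R" "X\<^sup>2 - X = t\<^sup>2 - t + (- (\<alpha> * \<beta> / 4 + (t\<^sup>2 - t)))"
    using artin_schreier_lift[OF t I_uminus] by blast
  then have Xeq: "X\<^sup>2 - X + \<alpha> * \<beta> / 4 = 0" by simp
  have "\<beta> / \<alpha> \<in> R"
    using red v_compare_divide(1)[OF nz(1), of \<beta>] unfolding reduced_def by auto
  then have "\<beta> / \<alpha> / (\<alpha> * \<beta> / 4) \<in> R" using \<theta> by blast
  moreover have "(2 / \<alpha>)\<^sup>2 = \<beta> / \<alpha> / (\<alpha> * \<beta> / 4)" using nz by (simp add: power2_eq_square)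
  ultimately have "2 / \<alpha> \<in> R" by (metis R_square)
  then have "- (2 / \<alpha> * X) \<in> R" using X(1) by blast
  then have z: "(- (2 / \<alpha> * X), 1) \<in> mcarrier v" by (simp add: mcarrier_def)
  have "mform \<alpha> \<beta> (- (2 / \<alpha> * X), 1) (- (2 / \<alpha> * X), 1) = 4 / \<alpha> * (X\<^sup>2 - X + \<alpha> * \<beta> / 4)"
    using nz by (simp add: mform_def power2_eq_square field_simps)
  then have "mform \<alpha> \<beta> (- (2 / \<alpha> * X), 1) (- (2 / \<alpha> * X), 1) = 0" unfolding Xeq by simp
  moreover have "(- (2 / \<alpha> * X), 1) \<noteq> (0 :: 'k \<times> 'k)" by (simp add: zero_prod_def)
  ultimately show False using an z unfolding isotropic_def by blast
qed

lemma coset_memE: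
  assumes "\<tau> \<in> a +o A" obtains j where "j \<in> A" "\<tau> = a + j"
  using assms by (auto simp: elt_set_plus_def)

text \<open>
  Each kind of invariant corresponds to one kind of change of \<open>\<tau>\<close>: odd invariants to
  relative changes in \<open>1 + I\<close>, even ones to adding a square followed by such a change, and
  exact ones to adding an element of \<open>4 R_AS\<close>.
\<close>

lemma representative_facts:
  assumes "has_gen_arf v \<alpha> \<beta> \<eta>" "\<not> isotropic v \<alpha> \<beta>" "\<tau> \<in> representatives \<eta>"
  shows "residually_anisotropic (\<alpha> * \<beta>)" "\<tau> / (\<alpha> * \<beta>) \<in> U" "norm_group v \<tau> = norm_group v (\<alpha> * \<beta>)"
proof -
  note nz = anisotropic_nonzero[OF assms(2)]
  have ab: "\<alpha> * \<beta> \<noteq> 0" using nz by simp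
  have four: "v 2 + v 2 = v 4" using v_mult[of 2 2] by simp
  have "residually_anisotropic (\<alpha> * \<beta>) \<and> \<tau> / (\<alpha> * \<beta>) \<in> U \<and> norm_group v \<tau> = norm_group v (\<alpha> * \<beta>)"
    using assms(1)
  proof cases
    case vanishing
    then show ?thesis using assms(2) by simp
  next
    case odd
    then have small: "4 / (\<alpha> * \<beta>) \<in> I"
      using v_compare_divide(2)[OF ab, of 4] four by (simp add: v_mult)
    obtain j where j: "j \<in> videal v (v (\<alpha> * \<beta>))" "\<tau> = \<alpha> * \<beta> + j"
      using assms(3) odd(1) by (auto elim: coset_memE)
    then have *: "(\<tau> - \<alpha> * \<beta>) / (\<alpha> * \<beta>) \<in> I"
      using v_compare_divide(2)[OF ab, of j] by (simp add: videal_def)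
    have "\<tau> / (\<alpha> * \<beta>) = 1 + (\<tau> - \<alpha> * \<beta>) / (\<alpha> * \<beta>)" using ab by (simp add: diff_divide_distrib)
    then have "\<tau> / (\<alpha> * \<beta>) \<in> U" using * by (metis U_1 U_add_I)
    then show ?thesis using residually_anisotropicI[OF ab small] norm_group_near_eq[OF ab *] by simp
  next
    case even
    then have small: "4 / (\<alpha> * \<beta>) \<in> I"
      using v_compare_divide(2)[OF ab, of 4] four by (simp add: v_mult)
    have abI: "\<alpha> * \<beta> \<in> I" using even by (simp add: videal_def v_mult)
    obtain j where j: "j \<in> J_set v (v (\<alpha> * \<beta>))" "\<tau> = \<alpha> * \<beta> + j"
      using assms(3) even(1) by (auto elim: coset_memE)
    \<comment> \<open>both parts of \<open>J_set\<close> are squares up to smaller terms; for the ideal the square is \<open>0\<close>\<close>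
    have "\<exists>b. b\<^sup>2 / (\<alpha> * \<beta>) \<in> R \<and> (j - b\<^sup>2) / (\<alpha> * \<beta>) \<in> I"
    proof (cases "j \<in> videal v (v (\<alpha> * \<beta>))")
      case True
      then have "(j - 0\<^sup>2) / (\<alpha> * \<beta>) \<in> I" using v_compare_divide(2)[OF ab, of j] by (simp add: videal_def)
      then show ?thesis by (intro exI[of _ 0]) simp
    next
      case False
      then obtain b where b: "v j = v (\<alpha> * \<beta>)" "j - b\<^sup>2 \<in> videal v (v j)"
        using j(1) unfolding J_set_def approx_square_def by blast
      then have 1: "(j - b\<^sup>2) / (\<alpha> * \<beta>) \<in> I" "j / (\<alpha> * \<beta>) \<in> U"
        using v_compare_divide(2)[OF ab, of "j - b\<^sup>2"] v_compare_divide(3)[OF ab, of j] by (auto simp: videal_def)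
      have "b\<^sup>2 / (\<alpha> * \<beta>) = j / (\<alpha> * \<beta>) - (j - b\<^sup>2) / (\<alpha> * \<beta>)" by (simp add: diff_divide_distrib)
      then have "b\<^sup>2 / (\<alpha> * \<beta>) \<in> R" using 1 by (metis R_diff R_I R_U)
      then show ?thesis using 1 by blast
    qed
    then obtain b where b: "b\<^sup>2 / (\<alpha> * \<beta>) \<in> R" "(j - b\<^sup>2) / (\<alpha> * \<beta>) \<in> I" by blast
    have u: "(\<alpha> * \<beta> + b\<^sup>2) / (\<alpha> * \<beta>) \<in> U"
      using add_square_unit[OF even(2) nz small b(1)] .
    then have s0: "\<alpha> * \<beta> + b\<^sup>2 \<noteq> 0" by (auto dest: U_nonzero)
    have "(\<tau> - (\<alpha> * \<beta> + b\<^sup>2)) / (\<alpha> * \<beta> + b\<^sup>2) = ((j - b\<^sup>2) / (\<alpha> * \<beta>)) / ((\<alpha> * \<beta> + b\<^sup>2) / (\<alpha> * \<beta>))"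
      using nz s0 by (simp add: j(2))
    then have near: "(\<tau> - (\<alpha> * \<beta> + b\<^sup>2)) / (\<alpha> * \<beta> + b\<^sup>2) \<in> I"
      using b(2) u by (metis I_divide_U)
    have "\<tau> / (\<alpha> * \<beta>) = (\<alpha> * \<beta> + b\<^sup>2) / (\<alpha> * \<beta>) + (j - b\<^sup>2) / (\<alpha> * \<beta>)"
      by (simp add: j(2) add_divide_distrib diff_divide_distrib)
    then have "\<tau> / (\<alpha> * \<beta>) \<in> U" using b(2) u by (metis U_add_I)
    then show ?thesis
      using residually_anisotropicI[OF ab small] norm_group_near_eq[OF s0 near]
        norm_group_add_square_eq[OF abI ab small b(1) u] by simp
  next
    case exact
    have \<theta>: "\<alpha> * \<beta> / 4 \<in> U"
      using exact v_compare_divide(3)[OF four_nonzero, of "\<alpha> * \<beta>"] four by (simp add: v_mult)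
    obtain p where p: "p \<in> R" "\<tau> = \<alpha> * \<beta> + 4 * (p\<^sup>2 - p)"
      using assms(3) exact(1) by (auto elim!: coset_memE simp: elt_set_times_def R_AS_def)
    have units: "\<alpha> * \<beta> / 4 + (t\<^sup>2 - t) \<in> U" if "t \<in> R" for t
      using exact_unit[OF exact(2,3) \<theta> that] .
    have pr: "residually_anisotropic (\<alpha> * \<beta>)" using residually_anisotropicI_units[OF \<theta> units] .
    have \<tau>4: "\<tau> / 4 = \<alpha> * \<beta> / 4 + (p\<^sup>2 - p)" by (simp add: p(2) add_divide_distrib)
    then have \<tau>U: "\<tau> / 4 \<in> U" using units[OF p(1)] by (simp only:)
    have "\<tau> / 4 + (t\<^sup>2 - t) \<in> U" if t: "t \<in> R" for t
    proof -
      obtain r where "r \<in> R" "(p\<^sup>2 - p) + (t\<^sup>2 - t) = r\<^sup>2 - r"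
        using R_AS_add[OF R_ASI[OF p(1)] R_ASI[OF t]] by (auto simp: R_AS_def)
      then show ?thesis using units[of r] unfolding \<tau>4 by (simp only: add.assoc)
    qed
    then have pr': "residually_anisotropic \<tau>" using residually_anisotropicI_units[OF \<tau>U] by blast
    obtain q where q: "q \<in> R" "- (p\<^sup>2 - p) = q\<^sup>2 - q"
      using R_AS_uminus[OF R_ASI[OF p(1)]] by (auto simp: R_AS_def)
    have ab_eq: "\<alpha> * \<beta> = \<tau> + 4 * (q\<^sup>2 - q)"
      unfolding q(2)[symmetric] p(2) by (simp only: mult_minus_right add_minus_cancel add.assoc add.right_inverse add_0_right)
    have 4: "4 / (\<alpha> * \<beta>) \<in> U" "4 / \<tau> \<in> U"
      using U_divide[OF U_1 \<theta>] U_divide[OF U_1 \<tau>U] by simp_all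
    have "norm_group v (\<alpha> * \<beta>) \<subseteq> norm_group v \<tau>"
      using norm_group_add_4AS_subset[of "\<alpha> * \<beta>" p, folded p(2), OF pr p(1) 4] .
    moreover have "norm_group v \<tau> \<subseteq> norm_group v (\<alpha> * \<beta>)"
      using norm_group_add_4AS_subset[of \<tau> q, folded ab_eq, OF pr' q(1) 4(2,1)] .
    moreover have "\<tau> / (\<alpha> * \<beta>) \<in> U" using U_divide[OF \<tau>U \<theta>] by simp
    ultimately show ?thesis using pr by blast
  qed
  then show "residually_anisotropic (\<alpha> * \<beta>)" "\<tau> / (\<alpha> * \<beta>) \<in> U" "norm_group v \<tau> = norm_group v (\<alpha> * \<beta>)"
    by auto
qed

lemma R_AS_0: "0 \<in> R_AS v"
  using R_ASI[of 0] by simp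

lemma self_representative:
  assumes "has_gen_arf v \<alpha> \<beta> \<eta>" "\<not> isotropic v \<alpha> \<beta>"
  shows "\<alpha> * \<beta> \<in> representatives \<eta>"
proof -
  have ab: "\<alpha> * \<beta> \<noteq> 0" using anisotropic_nonzero[OF assms(2)] by simp
  then obtain g where "v (\<alpha> * \<beta>) = Fin g" by (rule v_FinE)
  then have 0: "0 \<in> videal v (v (\<alpha> * \<beta>))" by (simp add: videal_def)
  show ?thesis using assms(1)
  proof cases
    case exact
    have "0 \<in> 4 *o R_AS v" using R_AS_0 by (force simp: elt_set_times_def)
    then show ?thesis unfolding exact(1) representatives.simps using set_plus_intro2 by force
  qed (use assms(2) 0 in \<open>force simp: elt_set_plus_def J_set_def\<close>)+
qed

lemma has_gen_arf_Vanishing_iff: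
  assumes "has_gen_arf v \<alpha> \<beta> \<eta>"
  shows "\<eta> = Vanishing \<longleftrightarrow> isotropic v \<alpha> \<beta>"
  using assms by cases auto

lemma gen_arf_val_eq:
  assumes "has_gen_arf v \<alpha> \<beta> \<eta>" "\<not> isotropic v \<alpha> \<beta>"
  shows "gen_arf_val v \<eta> = v (\<alpha> * \<beta>)"
proof -
  have nv: "\<eta> \<noteq> Vanishing" using has_gen_arf_Vanishing_iff assms by blast
  have "v (\<gamma> * \<delta>) = v (\<alpha> * \<beta>)" if "has_gen_arf v \<gamma> \<delta> \<eta>" for \<gamma> \<delta>
  proof -
    have "\<not> isotropic v \<gamma> \<delta>" using has_gen_arf_Vanishing_iff that nv by blast
    then have "\<gamma> * \<delta> / (\<alpha> * \<beta>) \<in> U"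
      using representative_facts(2)[OF assms] self_representative[OF that] by blast
    moreover have "\<alpha> * \<beta> \<noteq> 0" using anisotropic_nonzero[OF assms(2)] by simp
    ultimately show ?thesis using v_compare_divide(3) by blast
  qed
  then show ?thesis unfolding gen_arf_val_def if_not_P[OF nv] using assms(1) by (intro the_equality) metis+
qed

lemma norm_group_of_eq:
  assumes "has_gen_arf v \<alpha> \<beta> \<eta>" "\<not> isotropic v \<alpha> \<beta>"
  shows "norm_group_of v \<eta> = norm_group v (\<alpha> * \<beta>)"
  unfolding norm_group_of_def
  using representative_facts(3)[OF assms] self_representative[OF assms]
  by (intro the_equality) metis+

lemma norm_group_independent:
  assumes "is_gen_arf v \<eta>" "gen_arf_val v \<eta> \<le> v 2 + v 2"
    and "\<tau> \<in> representatives \<eta>" "\<tau>' \<in> representatives \<eta>"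
  shows "norm_group v \<tau> = norm_group v \<tau>'"
proof -
  obtain \<alpha> \<beta> where ab: "has_gen_arf v \<alpha> \<beta> \<eta>" using assms(1) by (auto simp: is_gen_arf_def)
  have "\<eta> \<noteq> Vanishing"
  proof
    assume "\<eta> = Vanishing"
    then have "v 2 + v 2 = \<infinity>" using assms(2) by (simp add: gen_arf_val_def)
    moreover obtain g where "v 2 = Fin g" by (rule v_FinE[OF two_nonzero])
    ultimately show False by simp
  qed
  then have "\<not> isotropic v \<alpha> \<beta>" using has_gen_arf_Vanishing_iff[OF ab] by blast
  then show ?thesis using representative_facts(3)[OF ab] assms(3,4) by metis
qed

section \<open>Isomorphisms as base changes\<close>

text \<open>
  The vectors \<open>(a, b)\<close> and \<open>(c, d)\<close> form a basis of \<open>M\<^bsub>\<alpha>,\<beta>\<^esub>\<close> with Gram matrix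
  \<open>\<gamma>, 1, \<delta>\<close>, that is, of the same shape as the standard basis of \<open>M\<^bsub>\<gamma>,\<delta>\<^esub>\<close>.
\<close>

definition base_change :: "'k \<Rightarrow> 'k \<Rightarrow> 'k \<Rightarrow> 'k \<Rightarrow> 'k \<Rightarrow> 'k \<Rightarrow> 'k \<Rightarrow> 'k \<Rightarrow> bool" where
  "base_change \<alpha> \<beta> \<gamma> \<delta> a b c d \<longleftrightarrow>
     a \<in> R \<and> b \<in> R \<and> c \<in> R \<and> d \<in> R \<and> a * d - b * c \<in> U \<and>
     \<gamma> = \<alpha> * a\<^sup>2 + 2 * a * b + \<beta> * b\<^sup>2 \<and>
     \<delta> = \<alpha> * c\<^sup>2 + 2 * c * d + \<beta> * d\<^sup>2 \<and>
     1 = \<alpha> * a * c + a * d + b * c + \<beta> * b * d"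

text \<open>
  The Gram determinant changes by the square of the determinant of the base change.
\<close>

lemma base_change_det:
  fixes \<alpha> \<beta> \<gamma> \<delta> a b c d :: 'k
  assumes "1 = \<alpha> * a * c + a * d + b * c + \<beta> * b * d"
    and "\<gamma> = \<alpha> * a\<^sup>2 + 2 * a * b + \<beta> * b\<^sup>2" "\<delta> = \<alpha> * c\<^sup>2 + 2 * c * d + \<beta> * d\<^sup>2"
  shows "1 - \<gamma> * \<delta> = (a * d - b * c)\<^sup>2 * (1 - \<alpha> * \<beta>)"
proof -
  have "(\<alpha> * a * c + a * d + b * c + \<beta> * b * d)\<^sup>2 = 1"
    using assms(1) by (metis power_one)
  then have "1 - \<gamma> * \<delta> = (\<alpha> * a * c + a * d + b * c + \<beta> * b * d)\<^sup>2 - \<gamma> * \<delta>"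
    by (simp only:)
  also have "\<dots> = (a * d - b * c)\<^sup>2 * (1 - \<alpha> * \<beta>)"
    unfolding assms(2,3) by (simp add: power2_eq_square algebra_simps)
  finally show ?thesis .
qed

text \<open>
  The inverse matrix. The number \<open>1\<close> has to be replaced by the inner product of the two basis
  vectors before the claims become polynomial identities.
\<close>

lemma base_change_sym:
  assumes "base_change \<alpha> \<beta> \<gamma> \<delta> a b c d"
  shows "\<exists>a' b' c' d'. base_change \<gamma> \<delta> \<alpha> \<beta> a' b' c' d'"
proof -
  define D where "D = a * d - b * c"
  have bc: "a \<in> R" "b \<in> R" "c \<in> R" "d \<in> R" "D \<in> U"
    "\<gamma> = \<alpha> * a\<^sup>2 + 2 * a * b + \<beta> * b\<^sup>2" "\<delta> = \<alpha> * c\<^sup>2 + 2 * c * d + \<beta> * d\<^sup>2"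
    and one: "1 = \<alpha> * a * c + a * d + b * c + \<beta> * b * d"
    using assms unfolding base_change_def D_def by auto
  have D0: "D \<noteq> 0" using bc by auto
  have 1: "\<alpha> * D\<^sup>2 = \<gamma> * d\<^sup>2 - 2 * (b * d) * (\<alpha> * a * c + a * d + b * c + \<beta> * b * d) + \<delta> * b\<^sup>2"
    unfolding bc(6,7) D_def by (simp add: power2_eq_square algebra_simps)
  have 2: "\<beta> * D\<^sup>2 = \<gamma> * c\<^sup>2 - 2 * (a * c) * (\<alpha> * a * c + a * d + b * c + \<beta> * b * d) + \<delta> * a\<^sup>2"
    unfolding bc(6,7) D_def by (simp add: power2_eq_square algebra_simps)
  have 3: "D\<^sup>2 = (a * d + b * c) * (\<alpha> * a * c + a * d + b * c + \<beta> * b * d) - \<gamma> * (c * d) - \<delta> * (a * b)"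
    unfolding bc(6,7) D_def by (simp add: power2_eq_square algebra_simps)
  note 123 = 1[folded one] 2[folded one] 3[folded one]
  have "\<alpha> = (\<alpha> * D\<^sup>2) / D\<^sup>2" "\<beta> = (\<beta> * D\<^sup>2) / D\<^sup>2" "1 = D\<^sup>2 / D\<^sup>2" using D0 by simp_all
  then have *: "\<alpha> = (\<gamma> * d\<^sup>2 - 2 * (b * d) * 1 + \<delta> * b\<^sup>2) / D\<^sup>2"
    "\<beta> = (\<gamma> * c\<^sup>2 - 2 * (a * c) * 1 + \<delta> * a\<^sup>2) / D\<^sup>2"
    "1 = ((a * d + b * c) * 1 - \<gamma> * (c * d) - \<delta> * (a * b)) / D\<^sup>2"
    using 123 by metis+
  have "\<alpha> = \<gamma> * (d / D)\<^sup>2 + 2 * (d / D) * (- b / D) + \<delta> * (- b / D)\<^sup>2"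
    by (subst *(1)) (simp add: power2_eq_square add_divide_distrib diff_divide_distrib)
  moreover have "\<beta> = \<gamma> * (- c / D)\<^sup>2 + 2 * (- c / D) * (a / D) + \<delta> * (a / D)\<^sup>2"
    by (subst *(2)) (simp add: power2_eq_square add_divide_distrib diff_divide_distrib)
  moreover have "1 = \<gamma> * (d / D) * (- c / D) + (d / D) * (a / D) + (- b / D) * (- c / D) + \<delta> * (- b / D) * (a / D)"
    by (subst *(3)) (simp add: power2_eq_square add_divide_distrib diff_divide_distrib ac_simps)
  moreover have "d / D * (a / D) - (- b / D) * (- c / D) = (a * d - b * c) / (D * D)"
    by (simp add: diff_divide_distrib mult.commute)
  then have "d / D * (a / D) - (- b / D) * (- c / D) = 1 / D"
    unfolding D_def[symmetric] using D0 by simp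
  then have "d / D * (a / D) - (- b / D) * (- c / D) \<in> U" using bc by (metis U_1 U_divide)
  moreover have "d / D \<in> R" "- b / D \<in> R" "- c / D \<in> R" "a / D \<in> R"
    using bc(1-5) by (meson R_divide_U R_uminus)+
  ultimately show ?thesis unfolding base_change_def by blast
qed

lemma base_change_imp_iso:
  assumes "base_change \<gamma> \<delta> \<alpha> \<beta> a b c d"
  shows "lattice_iso v \<alpha> \<beta> \<gamma> \<delta>"
proof -
  define D where "D = a * d - b * c"
  have bc: "a \<in> R" "b \<in> R" "c \<in> R" "d \<in> R" "D \<in> U"
    "\<alpha> = \<gamma> * a\<^sup>2 + 2 * a * b + \<delta> * b\<^sup>2" "\<beta> = \<gamma> * c\<^sup>2 + 2 * c * d + \<delta> * d\<^sup>2"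
    and one: "1 = \<gamma> * a * c + a * d + b * c + \<delta> * b * d"
    using assms unfolding base_change_def D_def by auto
  have D0: "D \<noteq> 0" using bc by auto
  define \<phi> where "\<phi> = (\<lambda>(p, q). (p * a + q * c, p * b + q * d))"
  define \<psi> where "\<psi> = (\<lambda>(p, q). ((p * d - q * c) / D, (q * a - p * b) / D))"
  have inv: "\<psi> (\<phi> (p, q)) = (p, q)" "\<phi> (\<psi> (p, q)) = (p, q)" for p q
  proof -
    have "(p * a + q * c) * d - (p * b + q * d) * c = p * D"
      "(p * b + q * d) * a - (p * a + q * c) * b = q * D"
      "(p * d - q * c) * a + (q * a - p * b) * c = p * D"
      "(p * d - q * c) * b + (q * a - p * b) * d = q * D"
      unfolding D_def by (simp_all add: algebra_simps)
    then show "\<psi> (\<phi> (p, q)) = (p, q)" "\<phi> (\<psi> (p, q)) = (p, q)"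
      using D0 unfolding \<phi>_def \<psi>_def by (simp_all flip: add_divide_distrib)
  qed
  have "bij_betw \<phi> (mcarrier v) (mcarrier v)"
  proof (rule bij_betw_byWitness[where f' = \<psi>])
    show "\<forall>z\<in>mcarrier v. \<psi> (\<phi> z) = z" "\<forall>z\<in>mcarrier v. \<phi> (\<psi> z) = z"
      using inv by (metis surj_pair)+
    show "\<phi> ` mcarrier v \<subseteq> mcarrier v" using bc(1-4) by (auto simp: \<phi>_def mcarrier_def)
    have "(p * d - q * c) / D \<in> R" "(q * a - p * b) / D \<in> R" if "p \<in> R" "q \<in> R" for p q
      using bc(1-5) that by (meson R_divide_U R_diff R_mult)+
    then show "\<psi> ` mcarrier v \<subseteq> mcarrier v" unfolding \<psi>_def mcarrier_def by auto
  qed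
  moreover have "\<phi> (z + w) = \<phi> z + \<phi> w" for z w
    by (cases z; cases w) (simp add: \<phi>_def algebra_simps)
  moreover have "\<phi> (mscale r z) = mscale r (\<phi> z)" for r z
    by (cases z) (simp add: \<phi>_def mscale_def algebra_simps)
  moreover have "mform \<gamma> \<delta> (\<phi> z) (\<phi> w) = mform \<alpha> \<beta> z w" for z w
  proof -
    obtain p q p' q' where zw: "z = (p, q)" "w = (p', q')" by (cases z; cases w)
    have "mform \<gamma> \<delta> (\<phi> z) (\<phi> w) = \<alpha> * (p * p') +
        (p * q' + q * p') * (\<gamma> * a * c + a * d + b * c + \<delta> * b * d) + \<beta> * (q * q')"
      unfolding zw \<phi>_def mform_def bc(6,7) by (simp add: power2_eq_square algebra_simps)
    then show ?thesis unfolding one[symmetric] zw mform_def by simp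
  qed
  ultimately show ?thesis unfolding lattice_iso_def by blast
qed

lemma one_minus_I_U: "x \<in> I \<Longrightarrow> 1 - x \<in> U"
  by (rule U_diff_I[OF U_1])

text \<open>
  The images of the standard basis vectors are the rows of the matrix. Its determinant is a
  unit because both Gram determinants are, \<open>\<alpha> \<beta>\<close> and \<open>\<gamma> \<delta>\<close> being in \<open>I\<close>.
\<close>

lemma iso_imp_base_change:
  assumes "lattice_iso v \<alpha> \<beta> \<gamma> \<delta>" "\<alpha> * \<beta> \<in> I" "\<gamma> * \<delta> \<in> I"
  shows "\<exists>a b c d. base_change \<gamma> \<delta> \<alpha> \<beta> a b c d"
proof -
  obtain \<phi> where \<phi>: "bij_betw \<phi> (mcarrier v) (mcarrier v)"
    "\<And>z w. z \<in> mcarrier v \<Longrightarrow> w \<in> mcarrier v \<Longrightarrow> mform \<gamma> \<delta> (\<phi> z) (\<phi> w) = mform \<alpha> \<beta> z w"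
    using assms(1) unfolding lattice_iso_def by blast
  have xy: "(1, 0) \<in> mcarrier v" "(0, 1) \<in> mcarrier v" by (auto simp: mcarrier_def)
  obtain a b c d where abcd: "\<phi> (1, 0) = (a, b)" "\<phi> (0, 1) = (c, d)" by (metis surj_pair)
  have "(a, b) \<in> mcarrier v" "(c, d) \<in> mcarrier v"
    using bij_betwE[OF \<phi>(1)] xy abcd by metis+
  then have R: "a \<in> R" "b \<in> R" "c \<in> R" "d \<in> R" by (auto simp: mcarrier_def)
  have 1: "\<alpha> = \<gamma> * a\<^sup>2 + 2 * a * b + \<delta> * b\<^sup>2"
    using \<phi>(2)[OF xy(1,1)] abcd by (simp add: mform_def power2_eq_square algebra_simps)
  have 2: "\<beta> = \<gamma> * c\<^sup>2 + 2 * c * d + \<delta> * d\<^sup>2"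
    using \<phi>(2)[OF xy(2,2)] abcd by (simp add: mform_def power2_eq_square algebra_simps)
  have 3: "1 = \<gamma> * a * c + a * d + b * c + \<delta> * b * d"
    using \<phi>(2)[OF xy] abcd by (simp add: mform_def algebra_simps)
  have u: "1 - \<alpha> * \<beta> \<in> U" "1 - \<gamma> * \<delta> \<in> U" using assms one_minus_I_U by blast+
  have "(a * d - b * c)\<^sup>2 = (1 - \<alpha> * \<beta>) / (1 - \<gamma> * \<delta>)"
    using base_change_det[OF 3 1 2] U_nonzero[OF u(2)] by (simp add: field_simps)
  then have "(a * d - b * c)\<^sup>2 \<in> U" using u by auto
  moreover have "a * d - b * c \<in> R" using R by auto
  ultimately have "a * d - b * c \<in> U"
    using U_iff I_mult_left[of "a * d - b * c" "a * d - b * c"] by (metis power2_eq_square)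
  then show ?thesis unfolding base_change_def using R 1 2 3 by blast
qed

text \<open>
  A row of a matrix with unit determinant contains a unit, so it is a primitive vector.
  Applied to a base change and its inverse, this shows that isomorphic lattices have the same
  maximal value of norms.
\<close>

lemma base_change_valuation_le:
  assumes "base_change \<alpha> \<beta> \<gamma> \<delta> a b c d" "maximal_valuation v \<alpha> \<beta>"
  shows "v \<delta> \<le> v \<beta>"
proof -
  have R: "c \<in> R" "d \<in> R" and "a \<in> R" "b \<in> R" "a * d - b * c \<in> U"
    and \<delta>: "\<delta> = \<alpha> * c\<^sup>2 + 2 * c * d + \<beta> * d\<^sup>2"
    using assms(1) unfolding base_change_def by auto
  then have "c \<in> U \<or> d \<in> U" using U_iff by (meson I_diff I_mult_left)
  then have "primitive v (c, d)" using R primitiveI by blast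
  moreover have "mform \<alpha> \<beta> (c, d) (c, d) = \<delta>"
    unfolding \<delta> by (simp add: mform_def power2_eq_square algebra_simps)
  ultimately show ?thesis using assms(2) unfolding maximal_valuation_def by metis
qed

text \<open>
  Dividing an isotropic vector by its entry of smaller value makes it primitive. Its norm has
  value \<open>\<infinity>\<close>, and so has \<open>\<beta>\<close> by maximality.
\<close>

lemma isotropic_imp_zero:
  assumes "isotropic v \<alpha> \<beta>" "maximal_valuation v \<alpha> \<beta>"
  shows "\<beta> = 0"
proof -
  obtain a b where z: "(a, b) \<noteq> (0 :: 'k \<times> 'k)" "mform \<alpha> \<beta> (a, b) (a, b) = 0"
    using assms(1) unfolding isotropic_def by (metis surj_pair)
  have eq: "\<alpha> * a\<^sup>2 + 2 * a * b + \<beta> * b\<^sup>2 = 0"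
    using z(2) by (simp add: mform_def power2_eq_square algebra_simps)
  have "\<exists>w. primitive v w \<and> mform \<alpha> \<beta> w w = 0"
  proof (cases "a \<noteq> 0 \<and> b / a \<in> R")
    case True
    have "mform \<alpha> \<beta> (1, b / a) (1, b / a) = (\<alpha> * a\<^sup>2 + 2 * a * b + \<beta> * b\<^sup>2) / a\<^sup>2"
      using True by (simp add: mform_def power2_eq_square field_simps)
    then show ?thesis using True eq primitiveI[of 1 "b / a"] by auto
  next
    case False
    then have b0: "b \<noteq> 0" using z(1) by (auto simp: zero_prod_def)
    have ab: "a / b \<in> R" using False R_dichotomy[of "b / a"] by (cases "a = 0") auto
    have "mform \<alpha> \<beta> (a / b, 1) (a / b, 1) = (\<alpha> * a\<^sup>2 + 2 * a * b + \<beta> * b\<^sup>2) / b\<^sup>2"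
      using b0 by (simp add: mform_def power2_eq_square field_simps)
    then show ?thesis using ab eq primitiveI[of "a / b" 1] by auto
  qed
  then have "v \<beta> = \<infinity>" using assms(2) unfolding maximal_valuation_def by force
  then show ?thesis by (metis v_FinE extended.distinct(1))
qed

section \<open>Fine Arf invariants and determinants\<close>

text \<open>
  The Gram determinants \<open>A - 1\<close> and \<open>B - 1\<close> agree modulo squares of units. Unlike
  membership of the difference in \<open>S_set\<close>, this is visibly an equivalence relation, and it is
  what base changes preserve.
\<close>

definition disc_equiv :: "'k \<Rightarrow> 'k \<Rightarrow> bool" where
  "disc_equiv A B \<longleftrightarrow> (\<exists>u\<in>U. 1 - B = u\<^sup>2 * (1 - A))"

lemma disc_equiv_refl: "disc_equiv A A"
  unfolding disc_equiv_def by (intro bexI[of _ 1]) auto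

lemma disc_equiv_sym: "disc_equiv A B \<Longrightarrow> disc_equiv B A"
proof -
  assume "disc_equiv A B"
  then obtain u where u: "u \<in> U" "1 - B = u\<^sup>2 * (1 - A)" unfolding disc_equiv_def by blast
  then have "1 - A = (1 / u)\<^sup>2 * (1 - B)" using U_nonzero[OF u(1)] by (simp add: power_divide)
  then show ?thesis unfolding disc_equiv_def using U_divide[OF U_1 u(1)] by blast
qed

lemma disc_equiv_trans: "disc_equiv A B \<Longrightarrow> disc_equiv B C \<Longrightarrow> disc_equiv A C"
proof -
  assume "disc_equiv A B" "disc_equiv B C"
  then obtain u w where u: "u \<in> U" "1 - B = u\<^sup>2 * (1 - A)" and w: "w \<in> U" "1 - C = w\<^sup>2 * (1 - B)"
    unfolding disc_equiv_def by blast
  have "1 - C = (w * u)\<^sup>2 * (1 - A)" unfolding w(2) u(2) by (simp add: power_mult_distrib)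
  then show ?thesis unfolding disc_equiv_def using U_mult[OF w(1) u(1)] by blast
qed

lemma I_double: "x / 2 \<in> I \<Longrightarrow> x \<in> I"
  using I_mult_left[of 2 "x / 2"] by simp

lemma S_set_iff: "s \<in> S_set v \<longleftrightarrow> (\<exists>t\<in>R. t\<^sup>2 / 2 \<in> I \<and> s = t\<^sup>2 - 2 * t)"
proof -
  have "v 2 < v t + v t \<longleftrightarrow> t\<^sup>2 / 2 \<in> I" for t
    using v_compare_divide(2)[OF two_nonzero, of "t\<^sup>2"] by (simp add: power2_eq_square v_mult)
  then show ?thesis unfolding S_set_def by blast
qed

text \<open>
  For \<open>D = B - A\<close> the quotient of \<open>(1 - B)(1 + D)\<close> by \<open>1 - A\<close> lies in \<open>1 + 4 I\<close> and is
  hence the square of a unit. So \<open>(1 - B) / (1 - A)\<close> is a square exactly if \<open>1 + D\<close> is, and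
  \<open>1 + D = (1 - t)\<^sup>2\<close> means \<open>D = t\<^sup>2 - 2 t\<close>. The bound on \<open>t\<close> that is part of \<open>S_set\<close> follows
  from \<open>D / 2 \<in> I\<close>.
\<close>

lemma diff_S_set_iff:
  assumes A: "A / 2 \<in> I" and B: "B / 2 \<in> I"
  shows "B - A \<in> S_set v \<longleftrightarrow> disc_equiv A B"
proof -
  define D where "D = B - A"
  have D: "D / 2 \<in> I" using I_diff[OF B A] by (simp add: D_def diff_divide_distrib)
  have A1: "1 - A \<in> U" using one_minus_I_U[OF I_double[OF A]] .
  have A0: "1 - A \<noteq> 0" using A1 by auto
  define E where "E = - (D * A + D\<^sup>2) / (1 - A)"
  have "E / 4 = - (D / 2 * (A / 2) + (D / 2) * (D / 2)) / (1 - A)"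
  proof -
    have "- (D * A + D\<^sup>2) / 4 = - (D / 2 * (A / 2) + (D / 2) * (D / 2))"
      by (simp add: power2_eq_square add_divide_distrib diff_divide_distrib)
    then show ?thesis unfolding E_def by (metis divide_divide_eq_left mult.commute)
  qed
  moreover have "- (D / 2 * (A / 2) + (D / 2) * (D / 2)) \<in> I" using A D by blast
  ultimately have E4: "E / 4 \<in> I" using A1 by (metis I_divide_U)
  obtain y where y: "y \<in> U" "y\<^sup>2 = 1 + E" using square_near_1[OF E4] .
  have "(1 - A) * (1 + E) = (1 - B) * (1 + D)"
    using A0 by (simp add: E_def distrib_left power2_eq_square) (simp add: D_def algebra_simps)
  then have key: "(1 - A) * y\<^sup>2 = (1 - B) * (1 + D)" unfolding y(2) .
  show ?thesis
  proof
    assume "B - A \<in> S_set v"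
    then obtain t where t: "t \<in> R" "t\<^sup>2 / 2 \<in> I" "D = t\<^sup>2 - 2 * t" unfolding D_def S_set_iff by blast
    have "t \<in> I" using I_square[OF I_double[OF t(2)]] .
    then have u: "1 - t \<in> U" by (rule one_minus_I_U)
    have "1 + D = (1 - t)\<^sup>2" unfolding t(3) by (simp add: power2_eq_square algebra_simps)
    then have "1 - B = (y / (1 - t))\<^sup>2 * (1 - A)"
      using key U_nonzero[OF u] by (simp add: power_divide field_simps)
    then show "disc_equiv A B" unfolding disc_equiv_def using U_divide[OF y(1) u] by blast
  next
    assume "disc_equiv A B"
    then obtain u where u: "u \<in> U" "1 - B = u\<^sup>2 * (1 - A)" unfolding disc_equiv_def by blast
    define t where "t = 1 - y / u"
    have "(1 - A) * y\<^sup>2 = (1 - A) * (u\<^sup>2 * (1 + D))" unfolding key u(2) by simp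
    then have "y\<^sup>2 = u\<^sup>2 * (1 + D)" using A0 by simp
    then have "(y / u)\<^sup>2 = 1 + D" using U_nonzero[OF u(1)] by (simp add: power_divide)
    then have tD: "t\<^sup>2 - 2 * t = D" by (simp add: t_def power2_eq_square algebra_simps)
    have t: "t \<in> R" unfolding t_def using y u by blast
    have "t\<^sup>2 = D + 2 * t" using tD by (simp add: algebra_simps)
    moreover have "D + 2 * t \<in> I" using I_double[OF D] t by blast
    ultimately have "t \<in> I" by (metis I_square)
    then have "D / 2 + t \<in> I" using D by blast
    moreover have "D / 2 + t = t\<^sup>2 / 2" unfolding tD[symmetric] by (simp add: diff_divide_distrib)
    ultimately show "B - A \<in> S_set v" unfolding S_set_iff D_def[symmetric] using t tD by auto
  qed
qed

lemma fine_arf_eq_iff: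
  assumes A: "\<alpha> * \<beta> / 2 \<in> I" and B: "\<gamma> * \<delta> / 2 \<in> I" and eq: "v (\<alpha> * \<beta>) = v (\<gamma> * \<delta>)"
  shows "fine_arf v \<alpha> \<beta> = fine_arf v \<gamma> \<delta> \<longleftrightarrow> disc_equiv (\<alpha> * \<beta>) (\<gamma> * \<delta>)"
proof -
  have fine: "w \<in> fine_arf v \<alpha> \<beta> \<longleftrightarrow> v w = v (\<alpha> * \<beta>) \<and> disc_equiv (\<alpha> * \<beta>) w"
    if "\<alpha> * \<beta> / 2 \<in> I" for w \<alpha> \<beta>
  proof -
    have "w \<in> \<alpha> * \<beta> +o S_set v \<longleftrightarrow> w - \<alpha> * \<beta> \<in> S_set v"
      by (simp add: elt_set_plus_def) (metis add_diff_cancel_left' add.commute diff_add_cancel)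
    moreover have "w / 2 \<in> I" if "v w = v (\<alpha> * \<beta>)"
      using that \<open>\<alpha> * \<beta> / 2 \<in> I\<close> v_compare_divide(2)[OF two_nonzero] by metis
    ultimately show ?thesis unfolding fine_arf_def using diff_S_set_iff[OF that] by blast
  qed
  show ?thesis
  proof
    assume "fine_arf v \<alpha> \<beta> = fine_arf v \<gamma> \<delta>"
    moreover have "\<gamma> * \<delta> \<in> fine_arf v \<gamma> \<delta>" using fine[OF B] disc_equiv_refl by blast
    ultimately show "disc_equiv (\<alpha> * \<beta>) (\<gamma> * \<delta>)" using fine[OF A] by blast
  next
    assume "disc_equiv (\<alpha> * \<beta>) (\<gamma> * \<delta>)"
    then have "disc_equiv (\<alpha> * \<beta>) w \<longleftrightarrow> disc_equiv (\<gamma> * \<delta>) w" for w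
      using disc_equiv_sym disc_equiv_trans by blast
    then show "fine_arf v \<alpha> \<beta> = fine_arf v \<gamma> \<delta>" using fine[OF A] fine[OF B] eq by auto
  qed
qed

section \<open>Classes of minimal norms\<close>

lemma coset_2R_eq_iff: "x +o (2 *o R) = y +o (2 *o R) \<longleftrightarrow> (x - y) / 2 \<in> R"
proof
  have mem: "z \<in> x +o (2 *o R) \<longleftrightarrow> (z - x) / 2 \<in> R" for z x
  proof
    assume "(z - x) / 2 \<in> R"
    moreover have "2 * ((z - x) / 2) = z - x" by (metis times_divide_eq_right nonzero_mult_div_cancel_left two_nonzero)
    then have "z = x + 2 * ((z - x) / 2)" by (metis add.commute diff_add_cancel)
    ultimately show "z \<in> x +o (2 *o R)" unfolding elt_set_plus_def elt_set_times_def by blast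
  qed (auto simp: elt_set_plus_def elt_set_times_def)
  show "x +o (2 *o R) = y +o (2 *o R) \<Longrightarrow> (x - y) / 2 \<in> R"
    using mem[of x x] mem[of x y] by simp
  assume "(x - y) / 2 \<in> R"
  then have "(z - x) / 2 \<in> R \<longleftrightarrow> (z - y) / 2 \<in> R" for z
    using R_add[of "(z - x) / 2" "(x - y) / 2"] R_diff[of "(z - y) / 2" "(x - y) / 2"]
    by (auto simp flip: add_divide_distrib diff_divide_distrib)
  then show "x +o (2 *o R) = y +o (2 *o R)" using mem by blast
qed

lemma coarse_class_eq_iff:
  "(\<lambda>c. (c * \<alpha>) +o (2 *o R)) ` unit_squares v = (\<lambda>c. (c * \<gamma>) +o (2 *o R)) ` unit_squares v
    \<longleftrightarrow> (\<exists>c\<in>U. (\<gamma> - c\<^sup>2 * \<alpha>) / 2 \<in> R)"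
proof -
  define F where "F \<alpha> = (\<lambda>c. (c * \<alpha>) +o (2 *o R)) ` unit_squares v" for \<alpha>
  have F: "X \<in> F \<alpha> \<longleftrightarrow> (\<exists>c\<in>U. X = (c\<^sup>2 * \<alpha>) +o (2 *o R))" for X \<alpha>
    unfolding F_def unit_squares_def by auto
  have sub: "F \<gamma> \<subseteq> F \<alpha>" if "c \<in> U" "(\<gamma> - c\<^sup>2 * \<alpha>) / 2 \<in> R" for c \<alpha> \<gamma>
  proof
    fix X assume "X \<in> F \<gamma>"
    then obtain e where e: "e \<in> U" "X = (e\<^sup>2 * \<gamma>) +o (2 *o R)" using F by blast
    have "(e\<^sup>2 * \<gamma> - (e * c)\<^sup>2 * \<alpha>) / 2 = e\<^sup>2 * ((\<gamma> - c\<^sup>2 * \<alpha>) / 2)"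
      by (simp add: power_mult_distrib right_diff_distrib)
    moreover have "e\<^sup>2 * ((\<gamma> - c\<^sup>2 * \<alpha>) / 2) \<in> R" using e that by blast
    ultimately have "X = ((e * c)\<^sup>2 * \<alpha>) +o (2 *o R)" unfolding e(2) coset_2R_eq_iff by (simp only:)
    then show "X \<in> F \<alpha>" using F U_mult[OF e(1) that(1)] by blast
  qed
  have "F \<alpha> = F \<gamma> \<longleftrightarrow> (\<exists>c\<in>U. (\<gamma> - c\<^sup>2 * \<alpha>) / 2 \<in> R)"
  proof
    assume "F \<alpha> = F \<gamma>"
    moreover have "\<gamma> +o (2 *o R) \<in> F \<gamma>" unfolding F by (intro bexI[of _ 1]) auto
    ultimately show "\<exists>c\<in>U. (\<gamma> - c\<^sup>2 * \<alpha>) / 2 \<in> R" using F coset_2R_eq_iff by metis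
  next
    assume "\<exists>c\<in>U. (\<gamma> - c\<^sup>2 * \<alpha>) / 2 \<in> R"
    then obtain c where c: "c \<in> U" "(\<gamma> - c\<^sup>2 * \<alpha>) / 2 \<in> R" by blast
    have "(\<alpha> - (1 / c)\<^sup>2 * \<gamma>) / 2 = - ((\<gamma> - c\<^sup>2 * \<alpha>) / 2 / c\<^sup>2)"
      using U_nonzero[OF c(1)] by (simp add: power_divide diff_divide_distrib)
    moreover have "- ((\<gamma> - c\<^sup>2 * \<alpha>) / 2 / c\<^sup>2) \<in> R" using c by blast
    ultimately have "F \<alpha> \<subseteq> F \<gamma>" using sub[OF U_divide[OF U_1 c(1)]] by metis
    then show "F \<alpha> = F \<gamma>" using sub[OF c] by blast
  qed
  then show ?thesis unfolding F_def .
qed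

section \<open>Constructing isomorphisms\<close>

text \<open>
  Let \<open>x' = (c, b)\<close> be the given vector of norm \<open>\<gamma>\<close> and \<open>k\<close> its inner product with \<open>y\<close>. Then
  \<open>y / k\<close> has inner product \<open>1\<close> with \<open>x'\<close> and norm \<open>\<epsilon> = \<beta> / k\<^sup>2\<close>. The sought vector is
  \<open>p x' + r (y / k)\<close> with \<open>p \<gamma> + r = 1\<close>; by the determinant formula its norm is \<open>\<delta>\<close> if
  \<open>r\<^sup>2 (1 - \<gamma> \<epsilon>) = 1 - \<gamma> \<delta>\<close>, and equivalence of the Gram determinants supplies such an \<open>r\<close>.

  It remains to see that \<open>t = 1 - r\<close> is divisible by \<open>\<gamma>\<close>. Its defining equation gives
  \<open>t (t - 2) = \<gamma> (\<epsilon> - \<delta>) / (1 - \<gamma> \<epsilon>)\<close>, whose value is at least \<open>v \<gamma> + v 2\<close>. If \<open>v t < v \<gamma>\<close>,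
  then also \<open>v t < v 2\<close> because \<open>\<gamma>\<close> divides \<open>2\<close>; so the left-hand side has value \<open>2 v t\<close>,
  which is less than \<open>v \<gamma> + v 2\<close>.
\<close>

lemma base_change_of_norm:
  assumes R: "b \<in> R" "\<beta> / 2 \<in> R" "\<delta> / 2 \<in> R" "\<gamma> \<in> R" and c: "c \<in> U"
    and \<gamma>: "\<gamma> = \<alpha> * c\<^sup>2 + 2 * c * b + \<beta> * b\<^sup>2" and k: "c + \<beta> * b \<in> U"
    and \<gamma>0: "\<gamma> \<noteq> 0" "2 / \<gamma> \<in> R" and de: "disc_equiv (\<alpha> * \<beta>) (\<gamma> * \<delta>)"
  shows "\<exists>a' b' c' d'. base_change \<alpha> \<beta> \<gamma> \<delta> a' b' c' d'"
proof -
  obtain u where u: "u \<in> U" "1 - \<gamma> * \<delta> = u\<^sup>2 * (1 - \<alpha> * \<beta>)" using de unfolding disc_equiv_def by blast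
  define k where "k = c + \<beta> * b"
  have kU: "k \<in> U" and k0: "k \<noteq> 0" and c0: "c \<noteq> 0" using k c unfolding k_def by auto
  define \<epsilon> where "\<epsilon> = \<beta> / k\<^sup>2"
  define r where "r = u * k / c"
  have r: "r \<in> U" unfolding r_def using u kU c by blast
  have "\<beta> / 2 / k\<^sup>2 \<in> R" using R(2) kU by blast
  then have \<epsilon>2: "\<epsilon> / 2 \<in> R" unfolding \<epsilon>_def by (metis divide_divide_eq_left mult.commute)
  have "2 * (\<gamma> * (\<epsilon> / 2)) \<in> I" using \<epsilon>2 R(4) by blast
  then have \<gamma>\<epsilon>: "1 - \<gamma> * \<epsilon> \<in> U" using one_minus_I_U[of "\<gamma> * \<epsilon>"] by simp
  have "\<gamma> * \<beta> - k\<^sup>2 = c\<^sup>2 * (\<alpha> * \<beta> - 1)"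
    unfolding \<gamma> k_def by (simp add: power2_eq_square algebra_simps)
  then have "1 - \<gamma> * \<epsilon> = c\<^sup>2 * (1 - \<alpha> * \<beta>) / k\<^sup>2" using k0 by (simp add: \<epsilon>_def field_simps)
  then have req: "r\<^sup>2 * (1 - \<gamma> * \<epsilon>) = 1 - \<gamma> * \<delta>"
    using k0 c0 unfolding u(2) r_def by (simp add: power_mult_distrib power_divide)
  define t where "t = 1 - r"
  define p where "p = t / \<gamma>"
  have tR: "t \<in> R" unfolding t_def using r by blast
  have tt: "t * (t - 2) = \<gamma> * (\<epsilon> - \<delta>) / (1 - \<gamma> * \<epsilon>)"
  proof -
    have "t * (t - 2) * (1 - \<gamma> * \<epsilon>) = r\<^sup>2 * (1 - \<gamma> * \<epsilon>) - (1 - \<gamma> * \<epsilon>)"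
      by (simp add: t_def power2_eq_square algebra_simps)
    also have "\<dots> = \<gamma> * (\<epsilon> - \<delta>)" unfolding req by (simp add: algebra_simps)
    finally show ?thesis using U_nonzero[OF \<gamma>\<epsilon>] by (simp add: field_simps)
  qed
  have p: "p \<in> R"
  proof (rule ccontr)
    assume "p \<notin> R"
    then have q: "\<gamma> / t \<in> I" "t \<noteq> 0" using R_dichotomy[of p] by (auto simp: p_def)
    have "2 / \<gamma> * (\<gamma> / t) \<in> I" using q(1) \<gamma>0(2) by blast
    then have "2 / t \<in> I" using \<gamma>0(1) by simp
    then have "1 - 2 / t \<in> U" by (rule one_minus_I_U)
    moreover have "1 - 2 / t = \<gamma> / t * ((\<gamma> / t) * ((\<epsilon> / 2 - \<delta> / 2) * (2 / \<gamma>) / (1 - \<gamma> * \<epsilon>)))"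
    proof -
      have cancel: "\<gamma> / t * ((\<gamma> / t) * (x / 2 * (2 / \<gamma>) / k)) = (\<gamma> * x / k) / (t * t)" for x k
        using \<gamma>0(1) by simp
      have "\<gamma> / t * ((\<gamma> / t) * ((\<epsilon> / 2 - \<delta> / 2) * (2 / \<gamma>) / (1 - \<gamma> * \<epsilon>)))
          = (\<gamma> * (\<epsilon> - \<delta>) / (1 - \<gamma> * \<epsilon>)) / (t * t)"
        unfolding diff_divide_distrib[symmetric] by (rule cancel)
      also have "\<dots> = 1 - 2 / t" unfolding tt[symmetric] using q(2) by (simp add: diff_divide_distrib)
      finally show ?thesis ..
    qed
    moreover have "\<gamma> / t * ((\<gamma> / t) * ((\<epsilon> / 2 - \<delta> / 2) * (2 / \<gamma>) / (1 - \<gamma> * \<epsilon>))) \<in> I"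
    proof -
      have "(\<epsilon> / 2 - \<delta> / 2) * (2 / \<gamma>) / (1 - \<gamma> * \<epsilon>) \<in> R" using \<epsilon>2 R(3) \<gamma>0(2) \<gamma>\<epsilon> by blast
      then show ?thesis using q(1) by blast
    qed
    ultimately show False using U_iff by metis
  qed
  have pr: "p * \<gamma> + r = 1" using \<gamma>0(1) by (simp add: p_def t_def)
  have "p * \<gamma> + r / k * (c + \<beta> * b) = 1" using pr k0 by (simp flip: k_def)
  then have 1: "1 = \<alpha> * c * (p * c) + c * (p * b + r / k) + b * (p * c) + \<beta> * b * (p * b + r / k)"
    unfolding \<gamma> by (simp add: power2_eq_square algebra_simps)
  have "\<alpha> * (p * c)\<^sup>2 + 2 * (p * c) * (p * b + r / k) + \<beta> * (p * b + r / k)\<^sup>2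
      = p\<^sup>2 * \<gamma> + 2 * p * (r / k) * (c + \<beta> * b) + \<beta> * (r / k)\<^sup>2"
    unfolding \<gamma> by (simp only: power2_eq_square algebra_simps mult_2 mult_2_right)
  also have "\<dots> = p\<^sup>2 * \<gamma> + 2 * p * r + r\<^sup>2 * \<epsilon>"
    unfolding k_def[symmetric] using k0 by (simp add: \<epsilon>_def power_divide)
  also have "\<dots> = \<delta>"
  proof -
    have "\<gamma> * (p\<^sup>2 * \<gamma> + 2 * p * r + r\<^sup>2 * \<epsilon>) = (p * \<gamma> + r)\<^sup>2 - r\<^sup>2 * (1 - \<gamma> * \<epsilon>)"
      by (simp add: power2_eq_square algebra_simps)
    also have "\<dots> = \<gamma> * \<delta>" unfolding pr req by simp
    finally show ?thesis using \<gamma>0(1) by simp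
  qed
  finally have 2: "\<delta> = \<alpha> * (p * c)\<^sup>2 + 2 * (p * c) * (p * b + r / k) + \<beta> * (p * b + r / k)\<^sup>2" ..
  have "c * (p * b + r / k) - b * (p * c) = u"
    using k0 c0 by (simp add: r_def field_simps)
  then have 3: "c * (p * b + r / k) - b * (p * c) \<in> U" using u(1) by simp
  have 4: "c \<in> R" "b \<in> R" "p * c \<in> R" "p * b + r / k \<in> R" using p c R r kU by blast+
  show ?thesis unfolding base_change_def using 1 2 3 4 \<gamma> by blast
qed

text \<open>
  Completing the square: with \<open>t = - \<beta> b / (2 a)\<close> the quotient is
  \<open>a\<^sup>2 (1 + (4 / (\<alpha> \<beta>)) (t\<^sup>2 - t))\<close>, and \<open>t\<close> is integral because \<open>\<beta>\<close> is divisible by \<open>2\<close>.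
\<close>

lemma norm_in_norm_group:
  assumes nz: "\<alpha> \<noteq> 0" "\<beta> \<noteq> 0" and \<beta>: "\<beta> / 2 \<in> R" and a: "a \<in> U" and b: "b \<in> R"
  shows "(\<alpha> * a\<^sup>2 + 2 * a * b + \<beta> * b\<^sup>2) / \<alpha> \<in> norm_group v (\<alpha> * \<beta>)"
proof -
  have a0: "a \<noteq> 0" using a by auto
  define t where "t = - (\<beta> / 2 * b) / a"
  have t: "t \<in> R" unfolding t_def using \<beta> a b by (meson R_divide_U R_mult R_uminus)
  have tb: "a * t = - (\<beta> / 2 * b)" using a0 by (simp add: t_def)
  have expand: "a\<^sup>2 * (1 + k * (t\<^sup>2 - t)) = a\<^sup>2 + k * ((a * t) * (a * t) - a * (a * t))" for k
    by (simp add: power2_eq_square algebra_simps)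
  have "a\<^sup>2 * (1 + 4 / (\<alpha> * \<beta>) * (t\<^sup>2 - t)) = a\<^sup>2 + 4 / (\<alpha> * \<beta>) * ((a * t) * (a * t) - a * (a * t))"
    by (rule expand)
  also have "\<dots> = (\<alpha> * a\<^sup>2 + 2 * a * b + \<beta> * b\<^sup>2) / \<alpha>"
  proof -
    have "a\<^sup>2 + 2 / (\<alpha> * w) * (- (w * b) * - (w * b) - a * - (w * b)) = (\<alpha> * a\<^sup>2 + 2 * a * b + 2 * w * b\<^sup>2) / \<alpha>"
      if "w \<noteq> 0" for w
      using that nz by (simp add: power2_eq_square field_simps)
    from this[of "\<beta> / 2"] show ?thesis unfolding tb using nz by simp
  qed
  finally show ?thesis using norm_groupI[OF a t, of "\<alpha> * \<beta>"] by simp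
qed

text \<open>
  If \<open>a\<close> is a unit, \<open>norm_in_norm_group\<close> applies. Otherwise \<open>b\<close> and \<open>c\<close> are units, and then
  the norm \<open>\<delta>\<close> of the second vector has the value \<open>v 2\<close> only if \<open>v \<alpha> = v 2\<close> as well. In that
  case the reflection in \<open>x\<close>, which maps \<open>a\<close> to \<open>- a - 2 b / \<alpha>\<close> and fixes \<open>b\<close>, turns \<open>a\<close> into a
  unit without changing the norm.
\<close>

lemma base_change_fine_class:
  assumes bc: "base_change \<alpha> \<beta> \<gamma> \<delta> a b c d" and nz: "\<alpha> \<noteq> 0" "\<beta> \<noteq> 0" and \<alpha>: "2 / \<alpha> \<in> R"
    and \<beta>: "\<beta> / 2 \<in> U" and \<delta>: "\<delta> / 2 \<in> U"
  shows "\<gamma> / \<alpha> \<in> norm_group v (\<alpha> * \<beta>)"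
proof -
  have R: "a \<in> R" "b \<in> R" "c \<in> R" "d \<in> R" "a * d - b * c \<in> U"
    and \<gamma>: "\<gamma> = \<alpha> * a\<^sup>2 + 2 * a * b + \<beta> * b\<^sup>2" and \<delta>eq: "\<delta> = \<alpha> * c\<^sup>2 + 2 * c * d + \<beta> * d\<^sup>2"
    using bc unfolding base_change_def by auto
  have main: "(\<alpha> * e\<^sup>2 + 2 * e * b + \<beta> * b\<^sup>2) / \<alpha> \<in> norm_group v (\<alpha> * \<beta>)" if "e \<in> U" for e
    using norm_in_norm_group[OF nz R_U[OF \<beta>] that R(2)] .
  show ?thesis
  proof (cases "a \<in> U")
    case True
    then show ?thesis using main \<gamma> by simp
  next
    case False
    then have aI: "a \<in> I" using R U_iff by blast
    then have "b \<in> U" "c \<in> U" using R U_iff by (meson I_diff I_mult_left I_mult_right)+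
    have "2 / \<alpha> \<in> U"
    proof (rule ccontr)
      assume "2 / \<alpha> \<notin> U"
      then have \<alpha>I: "2 / \<alpha> \<in> I" using \<alpha> U_iff by blast
      \<comment> \<open>the equation for \<open>\<delta>\<close>, solved for \<open>c\<^sup>2\<close>\<close>
      have "c\<^sup>2 = 2 / \<alpha> * (\<delta> / 2 - c * d - \<beta> / 2 * d\<^sup>2)"
        using nz unfolding \<delta>eq by (simp add: field_simps)
      moreover have "2 / \<alpha> * (\<delta> / 2 - c * d - \<beta> / 2 * d\<^sup>2) \<in> I"
        using \<alpha>I R \<beta> \<delta> by blast
      ultimately show False using U_power[OF \<open>c \<in> U\<close>] U_iff by metis
    qed
    define e where "e = - a - 2 / \<alpha> * b"
    have "e \<in> U"
    proof -
      have "- (2 / \<alpha> * b) - a \<in> U" using \<open>2 / \<alpha> \<in> U\<close> \<open>b \<in> U\<close> aI by blast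
      then show ?thesis unfolding e_def by (simp only: minus_diff_commute)
    qed
    moreover have "\<gamma> = \<alpha> * e\<^sup>2 + 2 * e * b + \<beta> * b\<^sup>2"
      unfolding \<gamma> e_def using nz by (simp add: power2_eq_square field_simps)
    ultimately show ?thesis using main by simp
  qed
qed

text \<open>
  Modulo \<open>2 R\<close> the norm of \<open>(a, b)\<close> is \<open>\<alpha> a\<^sup>2\<close>. If \<open>a\<close> is not a unit, then \<open>c\<close> is, and
  \<open>\<delta> \<in> 2 R\<close> forces \<open>\<alpha> \<in> 2 R\<close>, so that both coarse classes are zero.
\<close>

lemma base_change_coarse_class:
  assumes bc: "base_change \<alpha> \<beta> \<gamma> \<delta> a b c d"
    and \<beta>: "\<beta> / 2 \<in> I" and \<delta>: "\<delta> / 2 \<in> I"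
  shows "\<exists>e\<in>U. (\<gamma> - e\<^sup>2 * \<alpha>) / 2 \<in> R"
proof -
  have R: "a \<in> R" "b \<in> R" "c \<in> R" "d \<in> R" "a * d - b * c \<in> U"
    and \<gamma>: "\<gamma> = \<alpha> * a\<^sup>2 + 2 * a * b + \<beta> * b\<^sup>2" and \<delta>eq: "\<delta> = \<alpha> * c\<^sup>2 + 2 * c * d + \<beta> * d\<^sup>2"
    using bc unfolding base_change_def by auto
  have half: "\<gamma> / 2 = \<alpha> / 2 * a\<^sup>2 + (a * b + \<beta> / 2 * b\<^sup>2)"
    unfolding \<gamma> by (simp add: add_divide_distrib)
  have rest: "a * b + \<beta> / 2 * b\<^sup>2 \<in> R" using R \<beta> by blast
  show ?thesis
  proof (cases "a \<in> U")
    case True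
    have "(\<gamma> - a\<^sup>2 * \<alpha>) / 2 = a * b + \<beta> / 2 * b\<^sup>2"
      using half by (simp add: diff_divide_distrib mult.commute)
    then show ?thesis using True rest by metis
  next
    case False
    then have aI: "a \<in> I" using R U_iff by blast
    then have c: "c \<in> U" using R U_iff by (meson I_diff I_mult_left I_mult_right)
    have "\<alpha> / 2 * c\<^sup>2 = \<delta> / 2 - c * d - \<beta> / 2 * d\<^sup>2"
      unfolding \<delta>eq by (simp add: add_divide_distrib)
    then have "\<alpha> / 2 = (\<delta> / 2 - c * d - \<beta> / 2 * d\<^sup>2) / c\<^sup>2"
      using U_nonzero[OF c] by (metis nonzero_mult_div_cancel_right power_not_zero)
    moreover have "(\<delta> / 2 - c * d - \<beta> / 2 * d\<^sup>2) / c\<^sup>2 \<in> R" using R \<beta> \<delta> c by blast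
    ultimately have \<alpha>2: "\<alpha> / 2 \<in> R" by metis
    have "\<gamma> / 2 - \<alpha> / 2 \<in> R" unfolding half using \<alpha>2 R rest by blast
    then show ?thesis by (intro bexI[of _ 1]) (simp_all add: diff_divide_distrib U_1)
  qed
qed

text \<open>
  The computation of \<open>norm_in_norm_group\<close> read backwards: \<open>b = - 2 c t / \<beta>\<close>, integral because
  \<open>\<beta>\<close> and \<open>2\<close> have the same value.
\<close>

lemma base_change_of_fine_class:
  assumes nz: "\<alpha> \<noteq> 0" "\<beta> \<noteq> 0" "\<gamma> \<noteq> 0" and R: "\<gamma> \<in> R" "2 / \<gamma> \<in> R" "\<delta> / 2 \<in> R"
    and \<beta>: "\<beta> / 2 \<in> U" and \<gamma>: "\<gamma> / \<alpha> \<in> norm_group v (\<alpha> * \<beta>)"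
    and de: "disc_equiv (\<alpha> * \<beta>) (\<gamma> * \<delta>)"
  shows "\<exists>a b c d. base_change \<alpha> \<beta> \<gamma> \<delta> a b c d"
proof -
  obtain c t where c: "c \<in> U" "t \<in> R" "\<gamma> / \<alpha> = c\<^sup>2 * (1 + 4 / (\<alpha> * \<beta>) * (t\<^sup>2 - t))"
    using \<gamma> norm_group_iff by blast
  define b where "b = - (c * t) / (\<beta> / 2)"
  have b: "b \<in> R" unfolding b_def using c \<beta> by (meson R_U R_divide_U R_mult R_uminus)
  have \<beta>b: "\<beta> * b = - (2 * (c * t))" using nz by (simp add: b_def)
  have "\<gamma> = \<alpha> * (c\<^sup>2 * (1 + 4 / (\<alpha> * \<beta>) * (t\<^sup>2 - t)))" unfolding c(3)[symmetric] using nz by simp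
  also have "\<dots> = \<alpha> * c\<^sup>2 + 2 * c * b + \<beta> * b\<^sup>2"
    unfolding b_def using nz by (simp add: power2_eq_square field_simps)
  finally have \<gamma>eq: "\<gamma> = \<alpha> * c\<^sup>2 + 2 * c * b + \<beta> * b\<^sup>2" .
  have "c - 2 * (c * t) \<in> U" using c by blast
  then have k: "c + \<beta> * b \<in> U" unfolding \<beta>b by simp
  show ?thesis
    using base_change_of_norm[OF b R_U[OF \<beta>] R(3,1) c(1) \<gamma>eq k nz(3) R(2) de] .
qed

text \<open>
  For \<open>\<gamma> = \<alpha> c\<^sup>2 + 2 r\<close> a vector \<open>(c, b)\<close> of norm \<open>\<gamma>\<close> requires \<open>e b\<^sup>2 + c b = r\<close> with
  \<open>e = \<beta> / 2 \<in> I\<close>. The monic equation for \<open>B = e b\<close> is \<open>B\<^sup>2 + c B = r e\<close>, and its root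
  near \<open>0\<close> satisfies \<open>b = r / (c + B)\<close>, which is integral.
\<close>

lemma base_change_of_coarse_class:
  assumes nz: "\<beta> \<noteq> 0" "\<gamma> \<noteq> 0" and R: "\<gamma> \<in> R" "2 / \<gamma> \<in> R" "\<delta> / 2 \<in> R"
    and \<beta>: "\<beta> / 2 \<in> I" and c: "c \<in> U" "(\<gamma> - c\<^sup>2 * \<alpha>) / 2 \<in> R"
    and de: "disc_equiv (\<alpha> * \<beta>) (\<gamma> * \<delta>)"
  shows "\<exists>a b c d. base_change \<alpha> \<beta> \<gamma> \<delta> a b c d"
proof -
  define r where "r = (\<gamma> - c\<^sup>2 * \<alpha>) / 2"
  have r: "r \<in> R" "\<gamma> = \<alpha> * c\<^sup>2 + 2 * r" using c(2) by (simp_all add: r_def field_simps)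
  define e where "e = \<beta> / 2"
  have e: "e \<in> I" "e \<noteq> 0" using \<beta> nz by (simp_all add: e_def)
  have "0\<^sup>2 + c * 0 + (- (r * e)) \<in> I" "2 * 0 + c \<in> U" "c \<in> R" "- (r * e) \<in> R"
    using r c e by (auto intro: I_uminus)
  then obtain B where B: "B \<in> R" "B\<^sup>2 + c * B + (- (r * e)) = 0" "B - 0 \<in> I"
    using hensel[of c "- (r * e)" 0] R_0 by metis
  have cB: "c + B \<in> U" using B(3) c by auto
  define b where "b = B / e"
  have Be: "B = b * e" using e by (simp add: b_def)
  have "(b * (c + B) - r) * e = 0" using B(2) unfolding Be by (simp add: power2_eq_square algebra_simps)
  then have bq: "b * (c + B) = r" using e by simp
  then have "b = r / (c + B)" using U_nonzero[OF cB] by (simp add: field_simps)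
  then have b: "b \<in> R" using r cB by (metis R_divide_U)
  have "\<gamma> = \<alpha> * c\<^sup>2 + 2 * (b * (c + b * e))" unfolding r(2) bq[symmetric] Be ..
  also have "\<dots> = \<alpha> * c\<^sup>2 + 2 * c * b + \<beta> * b\<^sup>2"
    by (simp add: e_def power2_eq_square algebra_simps)
  finally have \<gamma>eq: "\<gamma> = \<alpha> * c\<^sup>2 + 2 * c * b + \<beta> * b\<^sup>2" .
  have "\<beta> * b \<in> I" using I_double[OF \<beta>] b by blast
  then have k: "c + \<beta> * b \<in> U" using c by blast
  show ?thesis
    using base_change_of_norm[OF b R_I[OF \<beta>] R(3,1) c(1) \<gamma>eq k nz(2) R(2) de] .
qed

text \<open>
  Here \<open>2 / \<gamma>\<close> need not be integral (\<open>\<gamma>\<close> may even be \<open>0\<close>), so \<open>base_change_of_norm\<close> is not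
  available; but \<open>y / c\<close> already has the correct norm \<open>0\<close>.
\<close>

lemma base_change_vanishing:
  assumes c: "c \<in> U" "(\<gamma> - c\<^sup>2 * \<alpha>) / 2 \<in> R"
  shows "\<exists>a b c d. base_change \<alpha> 0 \<gamma> 0 a b c d"
proof -
  have c0: "c \<noteq> 0" using c by auto
  define b where "b = (\<gamma> - c\<^sup>2 * \<alpha>) / 2 / c"
  have b: "b \<in> R" unfolding b_def using c by blast
  have "2 * (c * b) = \<gamma> - c\<^sup>2 * \<alpha>" using c0 by (simp add: b_def)
  then have "\<gamma> = \<alpha> * c\<^sup>2 + 2 * c * b + 0 * b\<^sup>2" by (simp add: algebra_simps)
  moreover have "1 / c \<in> R" "c \<in> R" using c by blast+
  ultimately have "base_change \<alpha> 0 \<gamma> 0 c b 0 (1 / c)"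
    unfolding base_change_def using b c0 by simp
  then show ?thesis by blast
qed

section \<open>The classification\<close>

lemma iso_iff_base_change:
  assumes "\<alpha> * \<beta> \<in> I" "\<gamma> * \<delta> \<in> I"
  shows "lattice_iso v \<alpha> \<beta> \<gamma> \<delta> \<longleftrightarrow> (\<exists>a b c d. base_change \<alpha> \<beta> \<gamma> \<delta> a b c d)"
proof
  assume "lattice_iso v \<alpha> \<beta> \<gamma> \<delta>"
  then show "\<exists>a b c d. base_change \<alpha> \<beta> \<gamma> \<delta> a b c d"
    using iso_imp_base_change[OF _ assms] base_change_sym by meson
next
  assume "\<exists>a b c d. base_change \<alpha> \<beta> \<gamma> \<delta> a b c d"
  then show "lattice_iso v \<alpha> \<beta> \<gamma> \<delta>" using base_change_sym base_change_imp_iso by meson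
qed

text \<open>
  \<open>2 v(\<alpha>) \<le> v(\<alpha>) + v(\<beta>) \<le> 2 v(2)\<close>, in multiplicative form.
\<close>

lemma two_divide_alpha_R:
  assumes "reduced v \<alpha> \<beta>" "residually_anisotropic (\<alpha> * \<beta>)"
  shows "2 / \<alpha> \<in> R"
proof -
  have nz: "\<alpha> \<noteq> 0" "\<beta> \<noteq> 0" using assms(2) by (auto simp: residually_anisotropic_def)
  have "\<beta> / \<alpha> \<in> R" using assms(1) v_compare_divide(1)[OF nz(1), of \<beta>] by (simp add: reduced_def)
  then have "4 / (\<alpha> * \<beta>) * (\<beta> / \<alpha>) \<in> R" using assms(2) R_mult unfolding residually_anisotropic_def by blast
  moreover have "4 / (\<alpha> * \<beta>) * (\<beta> / \<alpha>) = (2 / \<alpha>)\<^sup>2" using nz by (simp add: power2_eq_square)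
  ultimately show ?thesis by (metis R_square)
qed

lemma has_gen_arf_reduced: "has_gen_arf v \<alpha> \<beta> \<eta> \<Longrightarrow> reduced v \<alpha> \<beta>"
  by (cases rule: has_gen_arf.cases) auto

lemma double_vring_iff: "x \<in> 2 *o R \<longleftrightarrow> x / 2 \<in> R"
proof
  assume "x / 2 \<in> R"
  moreover have "x = 2 * (x / 2)" by simp
  ultimately show "x \<in> 2 *o R" unfolding elt_set_times_def by blast
qed (auto simp: elt_set_times_def)

text \<open>
  The invariants are compared separately for \<open>v \<beta> > v 2\<close> (where constructing an isomorphism
  needs a further distinction for \<open>\<beta> = 0\<close>, the vanishing invariant) and for \<open>v \<beta> = v 2\<close>. Coarse
  classes never equal fine ones, and isomorphic lattices satisfy \<open>v \<beta> = v \<delta>\<close>; so in both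
  directions the two lattices fall into the same case.
\<close>

lemma lattice_classification:
  assumes val: "gen_arf_val v \<eta> > v 2"
    and \<beta>: "\<beta> / 2 \<in> R" and \<delta>: "\<delta> / 2 \<in> R"
    and ab: "has_gen_arf v \<alpha> \<beta> \<eta>" and cd: "has_gen_arf v \<gamma> \<delta> \<eta>"
  shows "lattice_iso v \<alpha> \<beta> \<gamma> \<delta> \<longleftrightarrow>
    fine_arf v \<alpha> \<beta> = fine_arf v \<gamma> \<delta> \<and> min_norm_class v \<eta> \<alpha> \<beta> = min_norm_class v \<eta> \<gamma> \<delta>"
proof -
  note red = has_gen_arf_reduced[OF ab] has_gen_arf_reduced[OF cd]
  have max: "maximal_valuation v \<alpha> \<beta>" "maximal_valuation v \<gamma> \<delta>" and R: "\<alpha> \<in> R" "\<gamma> \<in> R"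
    using red by (simp_all add: reduced_def)
  have nonvan: "\<not> isotropic v \<alpha> \<beta> \<longleftrightarrow> \<not> isotropic v \<gamma> \<delta>"
    using has_gen_arf_Vanishing_iff[OF ab] has_gen_arf_Vanishing_iff[OF cd] by blast
  have van: "\<beta> = 0" "\<delta> = 0" if "isotropic v \<alpha> \<beta>"
    using isotropic_imp_zero max that nonvan by blast+
  have veq: "v (\<alpha> * \<beta>) = v (\<gamma> * \<delta>)"
    using gen_arf_val_eq[OF ab] gen_arf_val_eq[OF cd] nonvan van by (metis mult_zero_right)
  have A: "\<alpha> * \<beta> / 2 \<in> I"
  proof (cases "isotropic v \<alpha> \<beta>")
    case False
    then show ?thesis using gen_arf_val_eq[OF ab] val v_compare_divide(2)[OF two_nonzero] by simp
  qed (use van in simp)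
  then have B: "\<gamma> * \<delta> / 2 \<in> I" using v_compare_divide(2)[OF two_nonzero] veq by metis
  note iso = iso_iff_base_change[OF I_double[OF A] I_double[OF B]]
  note fine = fine_arf_eq_iff[OF A B veq]
  have gt: "v x > v 2 \<longleftrightarrow> x / 2 \<in> I" for x using v_compare_divide(2)[OF two_nonzero] by blast
  define same_norms where "same_norms \<longleftrightarrow> min_norm_class v \<eta> \<alpha> \<beta> = min_norm_class v \<eta> \<gamma> \<delta>"
  have coarse: "same_norms \<longleftrightarrow> (\<exists>c\<in>U. (\<gamma> - c\<^sup>2 * \<alpha>) / 2 \<in> R)" if "\<beta> / 2 \<in> I" "\<delta> / 2 \<in> I"
    using that coarse_class_eq_iff[of \<alpha> \<gamma>] unfolding same_norms_def min_norm_class_def gt by simp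
  have mixed: "\<not> same_norms" if "\<beta> / 2 \<in> I \<longleftrightarrow> \<delta> / 2 \<notin> I"
    using that unfolding same_norms_def min_norm_class_def gt by auto
  have nz: "\<alpha> \<noteq> 0" "\<beta> \<noteq> 0" "\<gamma> \<noteq> 0" "\<delta> \<noteq> 0" and pr: "residually_anisotropic (\<alpha> * \<beta>)" "residually_anisotropic (\<gamma> * \<delta>)"
    and two: "2 / \<alpha> \<in> R" "2 / \<gamma> \<in> R" if an: "\<not> isotropic v \<alpha> \<beta>"
  proof -
    show "residually_anisotropic (\<alpha> * \<beta>)" "residually_anisotropic (\<gamma> * \<delta>)"
      using representative_facts(1)[OF ab an self_representative[OF ab an]]
        representative_facts(1)[OF cd] self_representative[OF cd] nonvan an by blast+
    then show "2 / \<alpha> \<in> R" "2 / \<gamma> \<in> R" using red two_divide_alpha_R by blast+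
    show "\<alpha> \<noteq> 0" "\<beta> \<noteq> 0" "\<gamma> \<noteq> 0" "\<delta> \<noteq> 0"
      using anisotropic_nonzero an nonvan by blast+
  qed
  have fine_class: "same_norms \<longleftrightarrow> \<gamma> / \<alpha> \<in> norm_group v (\<alpha> * \<beta>)"
    if an: "\<not> isotropic v \<alpha> \<beta>" and "\<beta> / 2 \<notin> I" "\<delta> / 2 \<notin> I"
  proof -
    let ?N = "norm_group v (\<alpha> * \<beta>)"
    have "same_norms \<longleftrightarrow> \<alpha> *o ?N = \<gamma> *o ?N"
      using that norm_group_of_eq[OF ab an] unfolding same_norms_def min_norm_class_def gt by simp
    also have "\<dots> \<longleftrightarrow> \<gamma> / \<alpha> \<in> ?N"
    proof
      assume eq: "\<alpha> *o ?N = \<gamma> *o ?N"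
      have "1 \<in> ?N" using norm_groupI[OF U_1 R_0, of "\<alpha> * \<beta>"] by simp
      then have "\<gamma> \<in> \<gamma> *o ?N" by (force simp: elt_set_times_def)
      then have "\<gamma> \<in> \<alpha> *o ?N" unfolding eq .
      then obtain n where "n \<in> ?N" "\<gamma> = \<alpha> * n" unfolding elt_set_times_def by blast
      then show "\<gamma> / \<alpha> \<in> ?N" using nz[OF an] by simp
    next
      assume "\<gamma> / \<alpha> \<in> ?N"
      then show "\<alpha> *o ?N = \<gamma> *o ?N"
        using norm_group_coset_eq[OF pr(1)[OF an], of "\<gamma> / \<alpha>" \<alpha>] nz[OF an] by simp
    qed
    finally show ?thesis .
  qed
  have aniso: "\<not> isotropic v \<alpha> \<beta>" if "\<beta> / 2 \<notin> I" using that van by auto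
  show ?thesis unfolding iso fine same_norms_def[symmetric]
  proof
    assume "\<exists>a b c d. base_change \<alpha> \<beta> \<gamma> \<delta> a b c d"
    then obtain a b c d where bc: "base_change \<alpha> \<beta> \<gamma> \<delta> a b c d" by blast
    then obtain a' b' c' d' where bc': "base_change \<gamma> \<delta> \<alpha> \<beta> a' b' c' d'"
      using base_change_sym by blast
    have disc: "disc_equiv (\<alpha> * \<beta>) (\<gamma> * \<delta>)"
      using bc base_change_det[of \<alpha> a c d b \<beta> \<gamma> \<delta>] unfolding base_change_def disc_equiv_def by blast
    have "v \<beta> = v \<delta>"
      using base_change_valuation_le[OF bc max(1)] base_change_valuation_le[OF bc' max(2)] by simp
    then have same: "\<beta> / 2 \<in> I \<longleftrightarrow> \<delta> / 2 \<in> I" using gt by metis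
    have same_norms
    proof (cases "\<beta> / 2 \<in> I")
      case True
      then show ?thesis using base_change_coarse_class[OF bc] coarse same by blast
    next
      case False
      note an = aniso[OF False]
      have "\<beta> / 2 \<in> U" "\<delta> / 2 \<in> U" using False same \<beta> \<delta> U_iff by blast+
      then show ?thesis
        using base_change_fine_class[OF bc nz(1,2)[OF an] two(1)[OF an]] fine_class an False same
        by blast
    qed
    then show "disc_equiv (\<alpha> * \<beta>) (\<gamma> * \<delta>) \<and> same_norms" using disc by blast
  next
    assume *: "disc_equiv (\<alpha> * \<beta>) (\<gamma> * \<delta>) \<and> same_norms"
    then have same: "\<beta> / 2 \<in> I \<longleftrightarrow> \<delta> / 2 \<in> I" using mixed by blast
    show "\<exists>a b c d. base_change \<alpha> \<beta> \<gamma> \<delta> a b c d"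
    proof (cases "\<beta> / 2 \<in> I")
      case True
      then obtain c where c: "c \<in> U" "(\<gamma> - c\<^sup>2 * \<alpha>) / 2 \<in> R" using coarse * same by blast
      show ?thesis
      proof (cases "isotropic v \<alpha> \<beta>")
        case True
        then show ?thesis using base_change_vanishing[OF c] van by simp
      next
        case False
        then show ?thesis
          using base_change_of_coarse_class[OF nz(2,3) R(2) two(2) \<delta> \<open>\<beta> / 2 \<in> I\<close> c] * by blast
      qed
    next
      case False
      note an = aniso[OF False]
      have "\<beta> / 2 \<in> U" using False \<beta> U_iff by blast
      moreover have "\<gamma> / \<alpha> \<in> norm_group v (\<alpha> * \<beta>)" using fine_class[OF an] False same * by blast
      ultimately show ?thesis
        using base_change_of_fine_class[OF nz(1,2,3)[OF an] R(2) two(2)[OF an] \<delta>] * by blast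
    qed
  qed
qed

end

theorem theorem4p5:
  fixes v :: "'k::field \<Rightarrow> 'g::linordered_ab_group_add extended"
  assumes "valuation v" and "two_henselian v" and "v 2 > 0"
  shows "(\<forall>\<eta>. is_gen_arf v \<eta> \<longrightarrow> gen_arf_val v \<eta> \<le> v 2 + v 2 \<longrightarrow>
            (\<forall>\<tau>\<in>representatives \<eta>. \<forall>\<tau>'\<in>representatives \<eta>. norm_group v \<tau> = norm_group v \<tau>'))
       \<and> (\<forall>\<eta>. is_gen_arf v \<eta> \<longrightarrow> gen_arf_val v \<eta> > v 2 \<longrightarrow>
            (\<forall>\<alpha> \<beta> \<gamma> \<delta>.
               \<alpha> \<in> vring v \<longrightarrow> \<beta> \<in> 2 *o vring v \<longrightarrow> v \<alpha> \<le> v \<beta> \<longrightarrow> maximal_valuation v \<alpha> \<beta> \<longrightarrow>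
               \<gamma> \<in> vring v \<longrightarrow> \<delta> \<in> 2 *o vring v \<longrightarrow> v \<gamma> \<le> v \<delta> \<longrightarrow> maximal_valuation v \<gamma> \<delta> \<longrightarrow>
               has_gen_arf v \<alpha> \<beta> \<eta> \<longrightarrow> has_gen_arf v \<gamma> \<delta> \<eta> \<longrightarrow>
               (lattice_iso v \<alpha> \<beta> \<gamma> \<delta> \<longleftrightarrow>
                  fine_arf v \<alpha> \<beta> = fine_arf v \<gamma> \<delta> \<and>
                  min_norm_class v \<eta> \<alpha> \<beta> = min_norm_class v \<eta> \<gamma> \<delta>)))"
proof -
  interpret dyadic_henselian v using assms by unfold_locales
  show ?thesis
    using norm_group_independent lattice_classification double_vring_iff by blast
qed

end
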